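(* Let $(l,Q,\omega,\varphi)$ be regular data (see context) with $\vartheta(1^-)<\infty$, and assume that $\Phi:(0,1)\to(0,\infty)$ is non-decreasing. Then $g(s)=(\bar\varsigma s)\wedge(2\Psi(1))$ for every $s\ge0$.
   Context: Regular data: $l,Q\in C^0([0,1],[0,\infty))$ with $l(1)=1$, $l^{-1}(\{0\})=Q^{-1}(\{0\})=\{0\}$, $Q$ increasing in a right neighbourhood of $0$, and $t\mapsto (l(t)/Q(1-t))^{1/2}$ (on $[0,1)$) increasing in a right neighbourhood of $0$; $\omega\in C^0([0,1],[0,\infty))$ with $\omega^{-1}(\{0\})=\{0\}$ such that the limit $\bar\varsigma:=\lim_{t\to0^+}(\omega(t)/Q(t))^{1/2}\in[0,\infty]$ exists; $\varphi\in C^0([0,\infty),[0,\infty))$ non-decreasing with $\lim_{t\to\infty}\varphi(t)\in(0,\infty)$, $\varphi^{-1}(0)=\{0\}$, right-differentiable at $0$ with $\varphi'(0^+)=1$; and the function $\vartheta(t):=\frac{\omega(1-t)}{Q(1-t)}l(t)$, $t\in[0,1)$, belongs to $C^1((0,1))$ with $\vartheta'>0$ on $(0,1)$. Then $\vartheta(0)=0$ and $\vartheta(1^-)=\bar\varsigma^2\in(0,\infty]$; set $\vartheta(1):=\vartheta(1^-)$. $\Psi(t):=\int_0^t\omega^{1/2}(1-\tau)\,d\tau$. For $s\ge0$, $$g(s):=\inf\int_0^1\big(\vartheta(v)|u'|^2+\omega(1-v)|v'|^2\big)^{1/2}dx$$ over $u,v\in H^1((0,1))$ with $u(0)=0$,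 $u(1)=s$, $0\le v\le1$, $v(0)=v(1)=1$. $\Phi(x):=2\int_x^1\Big(\frac{\vartheta(x)\,\omega(1-t)}{\vartheta(t)(\vartheta(t)-\vartheta(x))}\Big)^{1/2}dt$ for $x\in(0,1)$. *)

theory Defs
  imports "HOL-Analysis.Analysis"
begin

abbreviation unit_lebesgue :: "real measure" where
  "unit_lebesgue \<equiv> lebesgue_on {0<..<1}"

definition L2_unit :: "(real \<Rightarrow> real) \<Rightarrow> bool" where
  "L2_unit f \<longleftrightarrow> f \<in> borel_measurable unit_lebesgue \<and> integrable unit_lebesgue (\<lambda>x. (f x)\<^sup>2)"

definition test_fun_unit :: "(real \<Rightarrow> real) \<Rightarrow> bool" where
  "test_fun_unit \<eta> \<longleftrightarrow> \<eta> C1_differentiable_on UNIV \<and>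
     (\<exists>a b. 0 < a \<and> b < 1 \<and> (\<forall>x. x \<notin> {a..b} \<longrightarrow> \<eta> x = 0))"

text \<open>
  \<open>H1_unit f f'\<close> says that \<open>f\<close> belongs to the Sobolev space \<open>H\<^sup>1((0,1))\<close> and that \<open>f'\<close> is (a
  version of) its weak derivative. Test functions are of class \<open>C\<^sup>1\<close> with compact
  support in \<open>(0,1)\<close>, as in Brezis, \<^emph>\<open>Functional Analysis, Sobolev Spaces and Partial
  Differential Equations\<close>, Section 8.2.
\<close>

definition H1_unit :: "(real \<Rightarrow> real) \<Rightarrow> (real \<Rightarrow> real) \<Rightarrow> bool" where
  "H1_unit f f' \<longleftrightarrow> L2_unit f \<and> L2_unit f' \<and>
     (\<forall>\<eta>. test_fun_unit \<eta> \<longrightarrow>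
        (LINT x|unit_lebesgue. f x * deriv \<eta> x) = - (LINT x|unit_lebesgue. f' x * \<eta> x))"

definition theta0 :: "(real \<Rightarrow> real) \<Rightarrow> (real \<Rightarrow> real) \<Rightarrow> (real \<Rightarrow> real) \<Rightarrow> real \<Rightarrow> real" where
  "theta0 l Q \<omega> t = \<omega> (1 - t) / Q (1 - t) * l t"

definition regular_data ::
    "(real \<Rightarrow> real) \<Rightarrow> (real \<Rightarrow> real) \<Rightarrow> (real \<Rightarrow> real) \<Rightarrow> (real \<Rightarrow> real) \<Rightarrow> bool" where
  "regular_data l Q \<omega> \<phi> \<longleftrightarrow>
     continuous_on {0..1} l \<and> (\<forall>t\<in>{0..1}. 0 \<le> l t) \<and>
     continuous_on {0..1} Q \<and> (\<forall>t\<in>{0..1}. 0 \<le> Q t) \<and>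
     l 1 = 1 \<and>
     (\<forall>t\<in>{0..1}. l t = 0 \<longleftrightarrow> t = 0) \<and>
     (\<forall>t\<in>{0..1}. Q t = 0 \<longleftrightarrow> t = 0) \<and>
     (\<exists>\<delta>. 0 < \<delta> \<and> \<delta> < 1 \<and> strict_mono_on {0..\<delta>} Q) \<and>
     (\<exists>\<delta>. 0 < \<delta> \<and> \<delta> < 1 \<and> strict_mono_on {0..\<delta>} (\<lambda>t. sqrt (l t / Q (1 - t)))) \<and>
     continuous_on {0..1} \<omega> \<and> (\<forall>t\<in>{0..1}. 0 \<le> \<omega> t) \<and>
     (\<forall>t\<in>{0..1}. \<omega> t = 0 \<longleftrightarrow> t = 0) \<and>
     (\<exists>L :: ennreal. ((\<lambda>t. ennreal (sqrt (\<omega> t / Q t))) \<longlongrightarrow> L) (at_right 0)) \<and>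
     continuous_on {0..} \<phi> \<and> (\<forall>t\<ge>0. 0 \<le> \<phi> t) \<and>
     mono_on {0..} \<phi> \<and>
     (\<exists>L>0. (\<phi> \<longlongrightarrow> L) at_top) \<and>
     (\<forall>t\<ge>0. \<phi> t = 0 \<longleftrightarrow> t = 0) \<and>
     (\<phi> has_real_derivative 1) (at_right 0) \<and>
     theta0 l Q \<omega> C1_differentiable_on {0<..<1} \<and>
     (\<forall>t\<in>{0<..<1}. 0 < deriv (theta0 l Q \<omega>) t)"

definition sigma_bar :: "(real \<Rightarrow> real) \<Rightarrow> (real \<Rightarrow> real) \<Rightarrow> ennreal" where
  "sigma_bar Q \<omega> = Lim (at_right 0) (\<lambda>t. ennreal (sqrt (\<omega> t / Q t)))"

definition theta_at1 :: "(real \<Rightarrow> real) \<Rightarrow> (real \<Rightarrow> real) \<Rightarrow> (real \<Rightarrow> real) \<Rightarrow> ennreal" where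
  "theta_at1 l Q \<omega> = Lim (at_left 1) (\<lambda>t. ennreal (theta0 l Q \<omega> t))"

text \<open>
  The function \<open>\<vartheta>\<close> on \<open>[0,1]\<close>. At \<open>1\<close> the defining quotient has the form \<open>0/0\<close>, and the value is
  the left limit. Being real-valued, \<open>theta\<close>, and hence \<open>g_fun\<close> below, has the intended meaning
  only if that limit is finite.
\<close>

definition theta :: "(real \<Rightarrow> real) \<Rightarrow> (real \<Rightarrow> real) \<Rightarrow> (real \<Rightarrow> real) \<Rightarrow> real \<Rightarrow> real" where
  "theta l Q \<omega> t = (if t = 1 then enn2real (theta_at1 l Q \<omega>) else theta0 l Q \<omega> t)"

definition Psi :: "(real \<Rightarrow> real) \<Rightarrow> real \<Rightarrow> real" where
  "Psi \<omega> t = integral {0..t} (\<lambda>\<tau>. sqrt (\<omega> (1 - \<tau>)))"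

text \<open>
  Boundary values and the constraint on \<open>v\<close> refer to the representatives of \<open>u\<close> and \<open>v\<close> that are
  continuous on \<open>[0,1]\<close>; the primed variables are the weak derivatives.
\<close>

definition g_fun :: "(real \<Rightarrow> real) \<Rightarrow> (real \<Rightarrow> real) \<Rightarrow> (real \<Rightarrow> real) \<Rightarrow> real \<Rightarrow> ennreal" where
  "g_fun l Q \<omega> s =
     Inf {(\<integral>\<^sup>+x. ennreal (sqrt (theta l Q \<omega> (v x) * \<bar>u' x\<bar>\<^sup>2 + \<omega> (1 - v x) * \<bar>v' x\<bar>\<^sup>2)) \<partial>unit_lebesgue)
          | u u' v v'.
            H1_unit u u' \<and> H1_unit v v' \<and>
            continuous_on {0..1} u \<and> continuous_on {0..1} v \<and>
            u 0 = 0 \<and> u 1 = s \<and>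
            (\<forall>x\<in>{0..1}. 0 \<le> v x \<and> v x \<le> 1) \<and> v 0 = 1 \<and> v 1 = 1}"

text \<open>
  The integrand of \<open>Phi\<close> is nonnegative and singular at \<open>x\<close>, so the integral is taken in
  \<open>[0,\<infinity>]\<close>.
\<close>

definition Phi :: "(real \<Rightarrow> real) \<Rightarrow> (real \<Rightarrow> real) \<Rightarrow> (real \<Rightarrow> real) \<Rightarrow> real \<Rightarrow> ennreal" where
  "Phi l Q \<omega> x =
     2 * (\<integral>\<^sup>+t. ennreal (sqrt (theta l Q \<omega> x * \<omega> (1 - t) /
                     (theta l Q \<omega> t * (theta l Q \<omega> t - theta l Q \<omega> x)))) \<partial>lebesgue_on {x<..<1})"

end

theory Submission
  imports Defs
begin

text \<open>
  Let \<open>\<theta>\<close> and \<open>w\<close> be the coefficients of the metric \<open>\<theta>(v) du\<^sup>2 + w(v) dv\<^sup>2\<close>. For a curve whose smallest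
  \<open>v\<close>-value is \<open>c\<close>, put \<open>a = \<theta>(c)\<^sup>1\<^sup>/\<^sup>2\<close>. By Cauchy-Schwarz the speed is at least
  \<open>a u' + (w (1 - a\<^sup>2/\<theta>))\<^sup>1\<^sup>/\<^sup>2 |v'|\<close>, and since \<open>v\<close> goes from \<open>1\<close> down to \<open>c\<close> and back, the length is at least
  \<open>a s + H(a)\<close> with \<open>H(a) = 2 \<integral> (w (1 - a\<^sup>2/\<theta>))\<^sup>1\<^sup>/\<^sup>2\<close> over \<open>{\<theta> > a\<^sup>2}\<close>. By Tonelli, \<open>H(a)\<close> is the integral of \<open>\<Phi>\<close>,
  reparametrised by \<open>\<alpha> = \<theta>(x)\<^sup>1\<^sup>/\<^sup>2\<close>, over \<open>a < \<alpha> < \<sigma>\<close>. So \<open>H\<close> is concave if \<open>\<Phi>\<close> is non-decreasing, and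
  the minimum of \<open>a s + H(a)\<close> is attained at \<open>a = 0\<close> or \<open>a = \<sigma>\<close>; these two values are the
  lengths of the curve through \<open>v = 0\<close> and of the straight curve \<open>v = 1\<close>.
\<close>

section \<open>Sobolev functions on the unit interval\<close>

text \<open>The endpoints form a null set. This is the passage between gauge integrals over
  \<open>{0..1}\<close>, which carry the fundamental theorem of calculus, and the measure on the
  open interval in \<open>H1_unit\<close>.\<close>

lemma absolutely_integrable_on_01_iff:
  "f absolutely_integrable_on {0..1::real} \<longleftrightarrow> integrable unit_lebesgue f" for f :: "real \<Rightarrow> real"
  using absolutely_integrable_on_open_interval[where f = f and a = 0 and b = 1]
    set_integrable_eq[of "{0<..<1::real}" lebesgue f] by simp

lemma unit_lebesgue_integral_eq:
  fixes f :: "real \<Rightarrow> real"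
  assumes "f absolutely_integrable_on {0..1}"
  shows "(LINT x|unit_lebesgue. f x) = integral {0..1} f"
  using assms lebesgue_integral_eq_integral[of "{0<..<1}" f]
  by (simp add: absolutely_integrable_on_01_iff integral_open_interval_real)

text \<open>The measure is finite, so square integrability gives integrability: expanding (|y| -
  1)^2 >= 0 yields 2|y| <= 1 + y^2.\<close>

lemma L2_unit_absolutely_integrable:
  assumes "L2_unit f"
  shows "f absolutely_integrable_on {0..1}"
proof -
  have "integrable unit_lebesgue (\<lambda>x. 1 + (f x)\<^sup>2)"
    using assms absolutely_integrable_on_01_iff[of "\<lambda>x. 1"]
    by (intro Bochner_Integration.integrable_add) (auto simp: L2_unit_def absolutely_integrable_on_def)
  moreover have "\<bar>y\<bar> \<le> \<bar>1 + y\<^sup>2\<bar>" for y :: real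
  proof -
    have "0 \<le> (\<bar>y\<bar> - 1)\<^sup>2" by simp
    then show ?thesis unfolding power2_diff by simp
  qed
  ultimately have "integrable unit_lebesgue f"
    using assms by (intro Bochner_Integration.integrable_bound[of _ "\<lambda>x. 1 + (f x)\<^sup>2" f]) (auto simp: L2_unit_def)
  then show ?thesis by (simp add: absolutely_integrable_on_01_iff)
qed

lemma absolutely_integrable_continuous_mult:
  fixes f h :: "real \<Rightarrow> real"
  assumes "continuous_on {a..b} h" "f absolutely_integrable_on {a..b}"
  shows "(\<lambda>x. h x * f x) absolutely_integrable_on {a..b}"
  using assms
  by (intro absolutely_integrable_bounded_measurable_product_real continuous_imp_measurable_on_sets_lebesgue
      compact_imp_bounded compact_continuous_image) auto

section \<open>C1 step functions and one-sided averages\<close>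

lemma has_real_derivative_square_pos_part:
  "((\<lambda>t::real. (max 0 t)\<^sup>2) has_real_derivative 2 * max 0 t) (at t)"
proof -
  consider "t < 0" | "t = 0" | "0 < t" by linarith
  then show ?thesis
  proof cases
    case 1
    have "((\<lambda>t::real. 0) has_real_derivative 0) (at t)" by simp
    then have "((\<lambda>t::real. (max 0 t)\<^sup>2) has_real_derivative 0) (at t)"
      by (rule has_field_derivative_transform_within_open[of _ _ _ "{..<0}"]) (use 1 in auto)
    then show ?thesis using 1 by simp
  next
    case 2
    \<comment> \<open>The difference quotient of the squared positive part at 0 is again
      \<open>max 0 h\<close>.\<close>
    have "((\<lambda>h::real. max 0 h) \<longlongrightarrow> 0) (at 0)"
      using tendsto_max[OF tendsto_const[of 0] tendsto_ident_at[of "0::real" UNIV]] by simp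
    then have "((\<lambda>h::real. (max 0 h)\<^sup>2 / h) \<longlongrightarrow> 0) (at 0)"
      by (rule Lim_transform_eventually)
         (auto simp: eventually_at_filter max_def power2_eq_square)
    then show ?thesis using 2 by (simp add: DERIV_def)
  next
    case 3
    have "((\<lambda>t::real. t\<^sup>2) has_real_derivative 2 * t) (at t)"
      by (auto intro!: derivative_eq_intros)
    then have "((\<lambda>t::real. (max 0 t)\<^sup>2) has_real_derivative 2 * t) (at t)"
      by (rule has_field_derivative_transform_within_open[of _ _ _ "{0<..}"]) (use 3 in auto)
    then show ?thesis using 3 by simp
  qed
qed

text \<open>A quadratic spline: 2t^2 on [0,1/2] and 1 - 2(1-t)^2 on [1/2,1], continued by 0 on the
  left and 1 on the right. It is of class C1, the regularity asked of test functions.\<close>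

definition smooth_step :: "real \<Rightarrow> real" where
  "smooth_step t = 2 * ((max 0 t)\<^sup>2 - 2 * (max 0 (t - 1/2))\<^sup>2 + (max 0 (t - 1))\<^sup>2)"

text \<open>The hat function on [0,1] with peak 2 at 1/2, hence of integral 1; it is the derivative
  of \<open>smooth_step\<close>.\<close>

definition tent :: "real \<Rightarrow> real" where
  "tent t = 4 * (max 0 t - 2 * max 0 (t - 1/2) + max 0 (t - 1))"

lemma smooth_step_deriv: "(smooth_step has_real_derivative tent t) (at t)"
  unfolding smooth_step_def[abs_def] tent_def
  by (rule derivative_eq_intros DERIV_chain2[OF has_real_derivative_square_pos_part] refl | simp)+

lemma smooth_step_le_0: "t \<le> 0 \<Longrightarrow> smooth_step t = 0"
  by (simp add: smooth_step_def)

lemma smooth_step_ge_1: "1 \<le> t \<Longrightarrow> smooth_step t = 1"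
  by (simp add: smooth_step_def power2_eq_square algebra_simps)

lemma smooth_step_bounds: "0 \<le> smooth_step t \<and> smooth_step t \<le> 1"
proof -
  consider "t \<le> 0" | "0 \<le> t" "t \<le> 1/2" | "1/2 \<le> t" "t \<le> 1" | "1 \<le> t" by linarith
  then show ?thesis
  proof cases
    case 2
    then have "t\<^sup>2 \<le> (1/2)\<^sup>2" by (intro power_mono) auto
    then show ?thesis using 2 by (simp add: smooth_step_def power2_eq_square)
  next
    case 3
    then have "(1 - t)\<^sup>2 \<le> (1/2)\<^sup>2" "0 \<le> (1 - t)\<^sup>2" by (intro power_mono) auto
    moreover have "smooth_step t = 1 - 2 * (1 - t)\<^sup>2"
      using 3 by (simp add: smooth_step_def power2_eq_square algebra_simps)
    ultimately show ?thesis by (simp add: power2_eq_square)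
  qed (simp_all add: smooth_step_le_0 smooth_step_ge_1)
qed

lemma tent_nonneg: "0 \<le> tent t" and tent_eq_0: "t \<le> 0 \<or> 1 \<le> t \<Longrightarrow> tent t = 0"
  by (auto simp: tent_def max_def)

lemma continuous_on_tent: "continuous_on S (\<lambda>x. tent (f x))" if "continuous_on S f"
  unfolding tent_def by (intro continuous_intros that)

lemma continuous_on_smooth_step: "continuous_on S (\<lambda>x. smooth_step (f x))" if "continuous_on S f"
  unfolding smooth_step_def by (intro continuous_intros that)

lemma smooth_step_scaled_deriv:
  "((\<lambda>t. smooth_step ((t - x) / d)) has_real_derivative tent ((t - x) / d) / d) (at t)" if "d \<noteq> 0"
proof -
  have "((\<lambda>t. (t - x) / d) has_real_derivative 1 / d) (at t)"
    using that by (auto intro!: derivative_eq_intros)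
  from DERIV_chain2[OF smooth_step_deriv this] show ?thesis by simp
qed

text \<open>The rescaled tents are a one-sided approximate identity: nonnegative, of mass 1, and
  supported in \<open>{x..x + d n}\<close>, where \<open>f\<close> is close to \<open>f x\<close> by
  continuity.\<close>

lemma tent_average_tendsto:
  fixes f :: "real \<Rightarrow> real"
  assumes f: "continuous_on {0..1} f" and x: "0 \<le> x" "x < 1"
    and d: "\<And>n. 0 < d n" "\<And>n. x + d n \<le> 1" "d \<longlonglongrightarrow> 0"
  shows "(\<lambda>n. integral {0..1} (\<lambda>t. f t * (tent ((t - x) / d n) / d n))) \<longlonglongrightarrow> f x"
proof (rule LIMSEQ_I)
  fix e :: real assume e: "0 < e"
  obtain r where r: "0 < r" "\<And>t. t \<in> {0..1} \<Longrightarrow> dist t x < r \<Longrightarrow> dist (f t) (f x) < e/2"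
    using f x e unfolding continuous_on_iff by (metis atLeastAtMost_iff half_gt_zero less_eq_real_def)
  obtain N where N: "\<And>n. n \<ge> N \<Longrightarrow> d n < r"
    using LIMSEQ_D[OF d(3) r(1)] d(1) by (auto simp: less_imp_le)
  have "norm (integral {0..1} (\<lambda>t. f t * (tent ((t - x) / d n) / d n)) - f x) < e" if n: "n \<ge> N" for n
  proof -
    define k where "k t = tent ((t - x) / d n) / d n" for t
    have k_cont: "continuous_on {0..1} k"
      unfolding k_def using d(1)[of n] by (auto intro!: continuous_intros continuous_on_tent)
    have k_nonneg: "0 \<le> k t" for t
      unfolding k_def using d(1)[of n] tent_nonneg by (simp add: less_imp_le)
    have "(k has_integral (smooth_step ((1 - x) / d n) - smooth_step ((0 - x) / d n))) {0..1}"
      unfolding k_def using d(1)[of n]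
      by (intro fundamental_theorem_of_calculus)
         (auto simp flip: has_real_derivative_iff_has_vector_derivative
               intro!: has_field_derivative_at_within[OF smooth_step_scaled_deriv])
    moreover have "smooth_step ((1 - x) / d n) = 1" "smooth_step ((0 - x) / d n) = 0"
      using d(1,2)[of n] x by (auto intro!: smooth_step_ge_1 smooth_step_le_0 simp: field_simps)
    ultimately have k1: "(k has_integral 1) {0..1}" by simp
    have kf: "\<bar>(f t - f x) * k t\<bar> \<le> e/2 * k t" if "t \<in> {0..1}" for t
    proof (cases "x < t \<and> t < x + d n")
      case True
      then have "dist t x < r" using N[OF n] by (simp add: dist_real_def)
      then have "\<bar>f t - f x\<bar> \<le> e/2" using r(2) that by (fastforce simp: dist_real_def)
      then show ?thesis using k_nonneg[of t] using mult_right_mono[of "\<bar>f t - f x\<bar>" "e/2" "k t"] by (simp add: abs_mult)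
    next
      case False
      then have "k t = 0" unfolding k_def using d(1)[of n] by (subst tent_eq_0) (auto simp: field_simps)
      then show ?thesis by simp
    qed
    have fk: "(\<lambda>t. f t * k t) integrable_on {0..1}"
      by (intro integrable_continuous_real continuous_intros f k_cont)
    have "integral {0..1} (\<lambda>t. f t * k t) - f x = integral {0..1} (\<lambda>t. (f t - f x) * k t)"
    proof -
      have "((\<lambda>t. f t * k t - f x * k t) has_integral (integral {0..1} (\<lambda>t. f t * k t) - f x * 1)) {0..1}"
        by (intro has_integral_diff has_integral_mult_right k1 integrable_integral fk)
      then show ?thesis by (simp add: left_diff_distrib integral_unique)
    qed
    also have "norm \<dots> \<le> integral {0..1} (\<lambda>t. e/2 * k t)"
      using kf by (intro Henstock_Kurzweil_Integration.integral_norm_bound_integral integrable_continuous_real continuous_intros f k_cont) auto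
    also have "\<dots> = e/2" using integral_unique[OF k1] by simp
    finally show ?thesis using e unfolding k_def by simp
  qed
  then show "\<exists>N. \<forall>n\<ge>N. norm (integral {0..1} (\<lambda>t. f t * (tent ((t - x) / d n) / d n)) - f x) < e" by blast
qed

text \<open>
  Testing against smooth approximations of the indicator function of \<open>[x,y]\<close> identifies the
  increments of the continuous representative.
\<close>

lemma H1_unit_ftc_interior:
  assumes H: "H1_unit f f'" and f: "continuous_on {0..1} f" and xy: "0 < x" "x < y" "y < 1"
  shows "integral {x..y} f' = f y - f x"
proof -
  have f': "f' absolutely_integrable_on {0..1}"
    using H L2_unit_absolutely_integrable by (auto simp: H1_unit_def)
  \<comment> \<open>Being less than \<open>1 - y\<close>, the width \<open>d n\<close> keeps the
    support \<open>{x..y + d n}\<close> of the test function inside the open interval; the factor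
    1/2 makes this strict already for \<open>n = 0\<close>.\<close>
  define d where "d n = (1 - y) / 2 * inverse (Suc n)" for n
  have d: "\<And>n. 0 < d n" "\<And>n. d n < 1 - y" "d \<longlonglongrightarrow> 0"
  proof -
    fix n
    show "0 < d n" using xy by (simp add: d_def)
    have "d n \<le> (1 - y) / 2 * 1" unfolding d_def using xy
      by (intro mult_left_mono) (auto simp: divide_simps)
    then show "d n < 1 - y" using xy by (auto simp: field_simps)
    show "d \<longlonglongrightarrow> 0" unfolding d_def
      using tendsto_mult_left[OF LIMSEQ_inverse_real_of_nat, of "(1-y)/2"] by simp
  qed
  define \<eta> where "\<eta> n t = smooth_step ((t - x) / d n) - smooth_step ((t - y) / d n)" for n t
  define \<eta>' where "\<eta>' n t = tent ((t - x) / d n) / d n - tent ((t - y) / d n) / d n" for n t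
  have \<eta>_deriv: "(\<eta> n has_real_derivative \<eta>' n t) (at t)" for n t
    unfolding \<eta>_def[abs_def] \<eta>'_def using d(1)[of n]
    by (intro DERIV_diff smooth_step_scaled_deriv) auto
  have \<eta>'_cont: "continuous_on S (\<eta>' n)" for S n
    unfolding \<eta>'_def using d(1)[of n] by (auto intro!: continuous_intros continuous_on_tent)
  have \<eta>_cont: "continuous_on S (\<eta> n)" for S n
    unfolding \<eta>_def using d(1)[of n] by (auto intro!: continuous_intros continuous_on_smooth_step)
  have test: "test_fun_unit (\<eta> n)" for n
    unfolding test_fun_unit_def
  proof (intro conjI exI)
    show "\<eta> n C1_differentiable_on UNIV"
      unfolding C1_differentiable_on_def
      using \<eta>_deriv[of n] \<eta>'_cont[of UNIV n]
      by (intro exI[of _ "\<eta>' n"]) (auto simp: has_real_derivative_iff_has_vector_derivative)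
    show "0 < x" "y + d n < 1" using xy d(2)[of n] by auto
    show "\<forall>t. t \<notin> {x..y + d n} \<longrightarrow> \<eta> n t = 0"
    proof (intro allI impI)
      fix t assume "t \<notin> {x..y + d n}"
      then consider "t \<le> x" | "y + d n \<le> t" by fastforce
      then show "\<eta> n t = 0"
      proof cases
        case 1
        then have "(t - x) / d n \<le> 0" "(t - y) / d n \<le> 0"
          using xy d(1)[of n] by (auto simp: divide_le_0_iff)
        then show ?thesis by (simp add: \<eta>_def smooth_step_le_0)
      next
        case 2
        then have "1 \<le> (t - x) / d n" "1 \<le> (t - y) / d n"
          using xy d(1)[of n] by (auto simp: le_divide_eq)
        then show ?thesis by (simp add: \<eta>_def smooth_step_ge_1)
      qed
    qed
  qed
  have weak: "integral {0..1} (\<lambda>t. f t * \<eta>' n t) = - integral {0..1} (\<lambda>t. \<eta> n t * f' t)" for n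
  proof -
    have 1: "deriv (\<eta> n) = \<eta>' n" using \<eta>_deriv DERIV_imp_deriv by blast
    have "(LINT x|unit_lebesgue. f x * \<eta>' n x) = - (LINT x|unit_lebesgue. f' x * \<eta> n x)"
      using H test[of n] unfolding H1_unit_def 1[symmetric] by blast
    moreover have "(\<lambda>t. f t * \<eta>' n t) absolutely_integrable_on {0..1}"
      by (intro absolutely_integrable_continuous_real continuous_intros f \<eta>'_cont)
    moreover have "(\<lambda>t. \<eta> n t * f' t) absolutely_integrable_on {0..1}"
      by (intro absolutely_integrable_continuous_mult f' \<eta>_cont)
    ultimately show ?thesis by (simp add: unit_lebesgue_integral_eq mult.commute)
  qed
  \<comment> \<open>Limit of the left side of \<open>weak\<close>: one tent average at
    \<open>x\<close> minus one at \<open>y\<close>.\<close>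
  have "(\<lambda>n. integral {0..1} (\<lambda>t. f t * (tent ((t - x) / d n) / d n)) - integral {0..1} (\<lambda>t. f t * (tent ((t - y) / d n) / d n)))
      \<longlonglongrightarrow> f x - f y"
  proof (intro tendsto_diff tent_average_tendsto f d)
    show "x + d n \<le> 1" "y + d n \<le> 1" for n using xy d(2)[of n] by linarith+
  qed (use xy in auto)
  moreover have "integral {0..1} (\<lambda>t. f t * (tent ((t - x) / d n) / d n)) - integral {0..1} (\<lambda>t. f t * (tent ((t - y) / d n) / d n))
     = integral {0..1} (\<lambda>t. f t * \<eta>' n t)" for n
    unfolding \<eta>'_def right_diff_distrib using d(1)[of n]
    by (subst Henstock_Kurzweil_Integration.integral_diff)
       (auto intro!: integrable_continuous_real continuous_intros continuous_on_tent f)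
  ultimately have L1: "(\<lambda>n. - integral {0..1} (\<lambda>t. \<eta> n t * f' t)) \<longlonglongrightarrow> f x - f y"
    by (simp add: weak)
  \<comment> \<open>Limit of the right side of \<open>weak\<close>, by dominated convergence: the
    \<open>\<eta> n\<close> are bounded by 1 and converge pointwise to the indicator of
    \<open>{x<..y}\<close>, half-open because each step still vanishes where it starts.\<close>
  have L2: "(\<lambda>n. integral {0..1} (\<lambda>t. \<eta> n t * f' t)) \<longlonglongrightarrow> integral {0..1} (\<lambda>t. if t \<in> {x<..y} then f' t else 0)"
  proof (rule dominated_convergence(2))
    show "(\<lambda>t. \<eta> n t * f' t) integrable_on {0..1}" for n
      using absolutely_integrable_continuous_mult[OF \<eta>_cont f'] by (simp add: absolutely_integrable_on_def)
    show "(\<lambda>t. \<bar>f' t\<bar>) integrable_on {0..1}"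
      using f' by (simp add: absolutely_integrable_on_def)
    show "norm (\<eta> n t * f' t) \<le> \<bar>f' t\<bar>" for n t
    proof -
      have "\<bar>\<eta> n t\<bar> \<le> 1" unfolding \<eta>_def
        using smooth_step_bounds[of "(t - x) / d n"] smooth_step_bounds[of "(t - y) / d n"] by linarith
      then show ?thesis using mult_right_mono[of "\<bar>\<eta> n t\<bar>" 1 "\<bar>f' t\<bar>"] by (simp add: abs_mult)
    qed
    fix t
    have step_le: "smooth_step ((t - z) / d n) = 0" if "t \<le> z" for z n
      using that d(1)[of n] by (intro smooth_step_le_0) (auto simp: divide_le_0_iff)
    have step_gt: "(\<lambda>n. smooth_step ((t - z) / d n)) \<longlonglongrightarrow> 1" if "z < t" for z
    proof (rule tendsto_eventually)
      have "\<forall>\<^sub>F n in sequentially. d n < t - z"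
        using order_tendstoD(2)[OF d(3), of "t - z"] that by simp
      then show "\<forall>\<^sub>F n in sequentially. smooth_step ((t - z) / d n) = 1"
        by eventually_elim (use d(1) in \<open>auto intro!: smooth_step_ge_1 simp: le_divide_eq\<close>)
    qed
    have "(\<lambda>n. \<eta> n t) \<longlonglongrightarrow> (if t \<in> {x<..y} then 1 else 0)"
    proof -
      consider "t \<le> x" | "x < t" "t \<le> y" | "y < t" by linarith
      then show ?thesis
      proof cases
        case 1 then show ?thesis using xy by (simp add: \<eta>_def step_le)
      next
        case 2 then show ?thesis using xy step_gt[of x] by (simp add: \<eta>_def step_le)
      next
        case 3 then show ?thesis using xy tendsto_diff[OF step_gt[of x] step_gt[of y]] by (simp add: \<eta>_def)
      qed
    qed
    from tendsto_mult_right[OF this, of "f' t"]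
    show "(\<lambda>n. \<eta> n t * f' t) \<longlonglongrightarrow> (if t \<in> {x<..y} then f' t else 0)"
      by (simp add: if_distrib[of "\<lambda>c. c * f' t"] cong: if_cong)
  qed
  have "integral {0..1} (\<lambda>t. if t \<in> {x<..y} then f' t else 0)
      = integral {0..1} (\<lambda>t. if t \<in> {x..y} then f' t else 0)"
    by (rule integral_spike[of "{x}"]) auto
  also have "\<dots> = integral {x..y} f'"
    using xy by (subst Henstock_Kurzweil_Integration.integral_restrict_Int) (simp add: Int_absorb2)
  finally show ?thesis
    using LIMSEQ_unique[OF tendsto_minus[OF L1, simplified] L2] by simp
qed

text \<open>The function \<open>k\<close>, which is \<open>f\<close> minus the primitive of
  \<open>f'\<close>, is constant on the open interval by the interior version, and by continuity on
  its closure.\<close>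

lemma H1_unit_ftc:
  assumes H: "H1_unit f f'" and f: "continuous_on {0..1} f" and xy: "0 \<le> x" "x \<le> y" "y \<le> 1"
  shows "integral {x..y} f' = f y - f x"
proof -
  have f': "f' integrable_on {0..1}"
    using H L2_unit_absolutely_integrable by (auto simp: H1_unit_def absolutely_integrable_on_def)
  define k where "k z = f z - integral {0..z} f'" for z
  have k: "continuous_on {0..1} k"
    unfolding k_def by (intro continuous_intros f indefinite_integral_continuous_1 f')
  have k_diff: "k b - k a = f b - f a - integral {a..b} f'" if "0 \<le> a" "a \<le> b" "b \<le> 1" for a b
  proof -
    have "integral {0..a} f' + integral {a..b} f' = integral {0..b} f'"
      using that by (intro Henstock_Kurzweil_Integration.integral_combine integrable_subinterval_real[OF f']) auto
    then show ?thesis unfolding k_def by simp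
  qed
  obtain m :: real where m: "0 < m" "m < 1" using dense[of "0::real" 1] by auto
  have k_eq: "k a = k b" if "0 < a" "a < b" "b < 1" for a b
    using k_diff[of a b] H1_unit_ftc_interior[OF H f that] that by simp
  have k_const: "k z = k m" if "z \<in> {0<..<1}" for z
  proof (cases z m rule: linorder_cases)
    case less
    then show ?thesis using k_eq[of z m] that m by simp
  next
    case greater
    then show ?thesis using k_eq[of m z] that m by simp
  qed simp
  have k_const': "k z = k m" if "z \<in> {0..1}" for z
  proof (rule continuous_constant_on_closure[of "{0<..<1}" k])
    show "continuous_on (closure {0<..<1}) k" using k by simp
    show "z \<in> closure {0<..<1}" using that by simp
  qed (rule k_const)
  have "k y = k m" "k x = k m" using xy by (auto intro!: k_const' simp del: greaterThanLessThan_iff)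
  then show ?thesis using k_diff[of x y] xy by simp
qed

text \<open>Integration by parts: the fundamental theorem, applied to \<open>f\<close> times a test
  function, tolerates the finite set \<open>S\<close>, and the boundary terms vanish with the test
  function. This admits the piecewise linear competitors below.\<close>

lemma H1_unit_piecewiseI:
  assumes f: "continuous_on {0..1} f" and S: "finite S"
    and deriv: "\<And>x. x \<in> {0<..<1} - S \<Longrightarrow> (f has_real_derivative f' x) (at x)"
    and f': "f' \<in> borel_measurable borel" "\<And>x. \<bar>f' x\<bar> \<le> B"
  shows "H1_unit f f'"
  unfolding H1_unit_def
proof (intro conjI allI impI)
  show "L2_unit f"
    using absolutely_integrable_continuous_real[OF f] absolutely_integrable_continuous_real[OF continuous_on_power[OF f, of 2]]
    by (auto simp: L2_unit_def absolutely_integrable_on_01_iff)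
  have const: "(\<lambda>x::real. 1::real) absolutely_integrable_on {0..1}"
    by (intro absolutely_integrable_continuous_real continuous_intros)
  have bounded_int: "h absolutely_integrable_on {0..1}"
    if "h \<in> borel_measurable borel" "\<And>x. \<bar>h x\<bar> \<le> C" for h :: "real \<Rightarrow> real" and C
  proof -
    have "h \<in> borel_measurable (lebesgue_on {0..1})"
      using that(1) by (intro measurable_restrict_space1 measurable_completion) simp
    moreover have "bounded (h ` {0..1})" using that(2) by (auto simp: bounded_iff)
    ultimately show ?thesis
      using absolutely_integrable_bounded_measurable_product_real[OF _ _ _ const] by simp
  qed
  have f'_int: "f' absolutely_integrable_on {0..1}" by (rule bounded_int[OF f'])
  have "\<bar>(f' x)\<^sup>2\<bar> \<le> B\<^sup>2" for x using power_mono[OF f'(2), of x 2] by simp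
  then have "(\<lambda>x. (f' x)\<^sup>2) absolutely_integrable_on {0..1}"
    using f'(1) by (intro bounded_int) auto
  then show "L2_unit f'" using f'_int by (auto simp: L2_unit_def absolutely_integrable_on_01_iff)
  fix \<eta> assume "test_fun_unit \<eta>"
  then obtain D a b where D: "\<And>x. (\<eta> has_real_derivative D x) (at x)" "continuous_on UNIV D"
    and ab: "0 < a" "b < 1" "\<And>x. x \<notin> {a..b} \<Longrightarrow> \<eta> x = 0"
    unfolding test_fun_unit_def C1_differentiable_on_def
    by (auto simp: has_real_derivative_iff_has_vector_derivative)
  have deriv_\<eta>: "deriv \<eta> = D" using D(1) DERIV_imp_deriv by blast
  have \<eta>: "continuous_on {0..1} \<eta>"
    using D(1) by (intro continuous_at_imp_continuous_on) (auto intro: DERIV_isCont)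
  have i1: "(\<lambda>x. f x * D x) absolutely_integrable_on {0..1}"
    by (intro absolutely_integrable_continuous_real continuous_intros f continuous_on_subset[OF D(2)]) auto
  have i2: "(\<lambda>x. \<eta> x * f' x) absolutely_integrable_on {0..1}"
    by (intro absolutely_integrable_continuous_mult \<eta> f'_int)
  have "((\<lambda>x. f x * D x + \<eta> x * f' x) has_integral (f 1 * \<eta> 1 - f 0 * \<eta> 0)) {0..1}"
  proof (rule fundamental_theorem_of_calculus_interior_strong[OF S])
    show "((\<lambda>x. f x * \<eta> x) has_vector_derivative f x * D x + \<eta> x * f' x) (at x)" if "x \<in> {0<..<1} - S" for x
      using DERIV_mult[OF deriv[OF that] D(1)[of x]]
      by (simp add: has_real_derivative_iff_has_vector_derivative mult.commute add.commute)
  qed (auto intro: continuous_intros f \<eta>)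
  moreover have "\<eta> 0 = 0" "\<eta> 1 = 0" using ab by auto
  ultimately have "integral {0..1} (\<lambda>x. f x * D x) + integral {0..1} (\<lambda>x. \<eta> x * f' x) = 0"
    using i1 i2 by (subst Henstock_Kurzweil_Integration.integral_add[symmetric])
       (auto simp: absolutely_integrable_on_def integral_unique)
  then show "(LINT x|unit_lebesgue. f x * deriv \<eta> x) = - (LINT x|unit_lebesgue. f' x * \<eta> x)"
    using unit_lebesgue_integral_eq[OF i1] unit_lebesgue_integral_eq[OF i2] by (simp add: deriv_\<eta> mult.commute)
qed

lemma H1_unit_linear: "H1_unit (\<lambda>x. A * x + B) (\<lambda>x. A)"
  by (rule H1_unit_piecewiseI[where S = "{}" and B = "\<bar>A\<bar>"])
     (auto intro!: continuous_intros derivative_eq_intros)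

section \<open>Change of variables and calibration inequalities\<close>

text \<open>The estimate is local. On a short interval \<open>G (v x)\<close> is constant up to
  \<open>e\<close>, so the primitive of \<open>G\<close> changes by at most that constant times the
  increment of \<open>v\<close>, which the integral of \<open>\<bar>v' x\<bar>\<close> bounds.
  Bisection glues the short intervals, and \<open>e\<close> tends to 0.\<close>

lemma integral_chain_rule_le:
  fixes v v' G :: "real \<Rightarrow> real"
  assumes pq: "p \<le> q" and v: "continuous_on {p..q} v" and v': "v' absolutely_integrable_on {p..q}"
    and ftc: "\<And>x y. p \<le> x \<Longrightarrow> x \<le> y \<Longrightarrow> y \<le> q \<Longrightarrow> integral {x..y} v' = v y - v x"
    and G: "continuous_on {c..d} G" "\<And>z. z \<in> {c..d} \<Longrightarrow> 0 \<le> G z"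
    and range: "\<And>x. x \<in> {p..q} \<Longrightarrow> v x \<in> {c..d}"
  shows "\<bar>integral {c..v q} G - integral {c..v p} G\<bar> \<le> integral {p..q} (\<lambda>x. G (v x) * \<bar>v' x\<bar>)"
proof -
  define \<Gamma> where "\<Gamma> z = integral {c..z} G" for z
  have av': "(\<lambda>x. \<bar>v' x\<bar>) absolutely_integrable_on {p..q}"
    using v' by (simp add: absolutely_integrable_on_def)
  have Gv: "continuous_on {p..q} (\<lambda>x. G (v x))"
    using range by (intro continuous_on_compose2[OF G(1) v]) auto
  have abs_int: "(\<lambda>x. (G (v x) + e) * \<bar>v' x\<bar>) absolutely_integrable_on {p..q}" for e
    by (intro absolutely_integrable_continuous_mult continuous_intros Gv av')
  have int: "(\<lambda>x. (G (v x) + e) * \<bar>v' x\<bar>) integrable_on {a..b}" if "p \<le> a" "b \<le> q" for e a b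
    using absolutely_integrable_on_subinterval[OF abs_int] that by (auto simp: absolutely_integrable_on_def)
  have \<Gamma>_diff: "\<bar>\<Gamma> y - \<Gamma> x\<bar> \<le> m * \<bar>y - x\<bar>"
    if "c \<le> x" "x \<le> d" "c \<le> y" "y \<le> d" and m: "\<And>z. min x y \<le> z \<Longrightarrow> z \<le> max x y \<Longrightarrow> G z \<le> m" for x y m
    using that
  proof (induction x y rule: linorder_wlog)
    case (le x y)
    have iG: "G integrable_on {x..y}" "G integrable_on {c..y}"
      using le by (auto intro!: integrable_continuous_real continuous_on_subset[OF G(1)])
    have "\<Gamma> y - \<Gamma> x = integral {x..y} G"
      using Henstock_Kurzweil_Integration.integral_combine[of c x y G] le iG unfolding \<Gamma>_def by simp
    moreover have "0 \<le> integral {x..y} G"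
      using le G(2) by (intro integral_nonneg iG) auto
    moreover have "integral {x..y} G \<le> integral {x..y} (\<lambda>_. m)"
      using le by (intro integral_le iG) auto
    ultimately show ?case using le by (simp add: mult.commute)
  next
    case (sym x y)
    then show ?case by (simp add: abs_minus_commute max.commute min.commute)
  qed
  have approx: "\<bar>\<Gamma> (v q) - \<Gamma> (v p)\<bar> \<le> integral {p..q} (\<lambda>x. (G (v x) + e) * \<bar>v' x\<bar>)" if e: "0 < e" for e
  proof -
    \<comment> \<open>The local case of \<open>Bolzano\<close> ranges over all short intervals
      around a point, also those that leave \<open>{p..q}\<close>; the guards make \<open>P\<close>
      trivially true for these.\<close>
    define P where "P a b \<longleftrightarrow> p \<le> a \<longrightarrow> a \<le> b \<longrightarrow> b \<le> q \<longrightarrow>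
      \<bar>\<Gamma> (v b) - \<Gamma> (v a)\<bar> \<le> integral {a..b} (\<lambda>x. (G (v x) + e) * \<bar>v' x\<bar>)" for a b
    from pq have "P p q"
    proof (induction rule: Bolzano)
      case (trans a b c)
      show ?case unfolding P_def
      proof (intro impI)
        assume *: "p \<le> a" "a \<le> c" "c \<le> q"
        have "integral {a..b} (\<lambda>x. (G (v x) + e) * \<bar>v' x\<bar>) + integral {b..c} (\<lambda>x. (G (v x) + e) * \<bar>v' x\<bar>)
            = integral {a..c} (\<lambda>x. (G (v x) + e) * \<bar>v' x\<bar>)"
          using trans * by (intro Henstock_Kurzweil_Integration.integral_combine int) auto
        then show "\<bar>\<Gamma> (v c) - \<Gamma> (v a)\<bar> \<le> integral {a..c} (\<lambda>x. (G (v x) + e) * \<bar>v' x\<bar>)"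
          using trans * unfolding P_def by force
      qed
    next
      case (local x)
      then obtain \<delta> where \<delta>: "\<delta> > 0" "\<And>t. t \<in> {p..q} \<Longrightarrow> dist t x < \<delta> \<Longrightarrow> dist (G (v t)) (G (v x)) < e/2"
        using Gv e unfolding continuous_on_iff by (metis atLeastAtMost_iff half_gt_zero)
      have "P a b" if ab: "a \<le> x" "x \<le> b" "b - a < \<delta>" for a b
        unfolding P_def
      proof (intro impI)
        assume *: "p \<le> a" "a \<le> b" "b \<le> q"
        \<comment> \<open>\<open>m\<close> bounds \<open>G (v t)\<close> from above on the whole
          short interval and exceeds it by at most \<open>e\<close>.\<close>
        define m where "m = G (v x) + e/2"
        have m: "G (v t) \<le> m" "m \<le> G (v t) + e" if "t \<in> {a..b}" for t
        proof -
          have "\<bar>t - x\<bar> < \<delta>" using that ab unfolding atLeastAtMost_iff by linarith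
          then have "\<bar>G (v t) - G (v x)\<bar> < e/2" using \<delta>(2)[of t] that * by (simp add: dist_real_def)
          then show "G (v t) \<le> m" "m \<le> G (v t) + e" unfolding m_def by linarith+
        qed
        have m0: "0 \<le> m" using G(2)[OF range[of x]] local e unfolding m_def by simp
        have iv': "v' integrable_on {a..b}" "(\<lambda>x. \<bar>v' x\<bar>) integrable_on {a..b}"
          using absolutely_integrable_on_subinterval[OF v', of a b] * by (auto simp: absolutely_integrable_on_def)
        have "\<bar>\<Gamma> (v b) - \<Gamma> (v a)\<bar> \<le> m * \<bar>v b - v a\<bar>"
        proof (rule \<Gamma>_diff)
          fix z assume z: "min (v a) (v b) \<le> z" "z \<le> max (v a) (v b)"
          \<comment> \<open>By the intermediate value theorem every value between \<open>v a\<close>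
            and \<open>v b\<close> is attained on \<open>{a..b}\<close>, where \<open>m\<close>
            bounds \<open>G\<close>.\<close>
          have "\<exists>t\<in>closed_segment a b. v t = z"
            using z * by (intro IVT'_closed_segment_real continuous_on_subset[OF v])
              (auto simp: closed_segment_eq_real_ivl split: if_splits)
          then show "G z \<le> m" using m(1) * by (auto simp: closed_segment_eq_real_ivl)
        qed (use range[of a] range[of b] * in auto)
        also have "\<dots> = m * \<bar>integral {a..b} v'\<bar>" using ftc[of a b] * by simp
        also have "\<dots> \<le> m * integral {a..b} (\<lambda>x. \<bar>v' x\<bar>)"
          using Henstock_Kurzweil_Integration.integral_norm_bound_integral[OF iv'] m0 by (intro mult_left_mono) auto
        also have "\<dots> = integral {a..b} (\<lambda>x. m * \<bar>v' x\<bar>)" by simp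
        also have "\<dots> \<le> integral {a..b} (\<lambda>x. (G (v x) + e) * \<bar>v' x\<bar>)"
          using iv' m * by (intro integral_le int integrable_on_mult_right mult_right_mono) auto
        finally show "\<bar>\<Gamma> (v b) - \<Gamma> (v a)\<bar> \<le> integral {a..b} (\<lambda>x. (G (v x) + e) * \<bar>v' x\<bar>)" .
      qed
      then show ?case using \<delta>(1) by blast
    qed
    then show ?thesis using pq by (simp add: P_def)
  qed
  define I where "I = integral {p..q} (\<lambda>x. \<bar>v' x\<bar>)"
  have I: "0 \<le> I" unfolding I_def using av' by (intro integral_nonneg) (auto simp: absolutely_integrable_on_def)
  have split: "integral {p..q} (\<lambda>x. (G (v x) + e) * \<bar>v' x\<bar>) = integral {p..q} (\<lambda>x. G (v x) * \<bar>v' x\<bar>) + e * I" for e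
    unfolding distrib_right I_def using int[of p q 0] av'
    by (subst Henstock_Kurzweil_Integration.integral_add) (auto simp: absolutely_integrable_on_def intro!: integrable_on_mult_right)
  have "\<bar>\<Gamma> (v q) - \<Gamma> (v p)\<bar> \<le> integral {p..q} (\<lambda>x. G (v x) * \<bar>v' x\<bar>)"
  proof (rule field_le_epsilon)
    fix e :: real assume e: "0 < e"
    \<comment> \<open>Dividing by \<open>I + 1\<close> rather than \<open>I\<close> covers the case
      \<open>I = 0\<close>.\<close>
    have "e / (I + 1) * I \<le> e" using e I by (simp add: field_simps)
    then show "\<bar>\<Gamma> (v q) - \<Gamma> (v p)\<bar> \<le> integral {p..q} (\<lambda>x. G (v x) * \<bar>v' x\<bar>) + e"
      using approx[of "e / (I + 1)"] e I unfolding split by simp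
  qed
  then show ?thesis unfolding \<Gamma>_def .
qed

text \<open>\<open>ennreal\<close> cuts negative values off at 0, so the right side integrates the
  positive part of \<open>f\<close>. The calibrated integrand can be negative, since
  \<open>u'\<close> carries a sign.\<close>

lemma ennreal_integral_le_nn_integral:
  assumes "integrable M f"
  shows "ennreal (\<integral>x. f x \<partial>M) \<le> (\<integral>\<^sup>+x. ennreal (f x) \<partial>M)"
proof -
  have i: "integrable M (\<lambda>x. max 0 (f x))" using assms by simp
  have "(\<integral>x. f x \<partial>M) \<le> (\<integral>x. max 0 (f x) \<partial>M)"
    using assms i by (intro integral_mono) auto
  moreover have "(\<integral>\<^sup>+x. ennreal (max 0 (f x)) \<partial>M) = ennreal (\<integral>x. max 0 (f x) \<partial>M)"
    using i by (intro nn_integral_eq_integral) auto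
  ultimately show ?thesis by (simp add: ennreal_leI ennreal_max_0)
qed

text \<open>Cauchy-Schwarz for the unit vector \<open>(k, m)\<close> against \<open>(X, Y)\<close>.
  The coefficient of \<open>p\<close> does not depend on \<open>T\<close>, so along a curve that
  term integrates exactly to a multiple of the increment of \<open>u\<close>.\<close>

lemma calibration_bound:
  fixes A T W p q :: real
  assumes A: "0 \<le> A" "A \<le> T" and W: "0 \<le> W"
  shows "sqrt A * p + sqrt (W * (1 - A / T)) * \<bar>q\<bar> \<le> sqrt (T * \<bar>p\<bar>\<^sup>2 + W * \<bar>q\<bar>\<^sup>2)"
proof (cases "T = 0")
  \<comment> \<open>Here \<open>A = 0\<close> as well, and \<open>A / T\<close> is 0 by the
    convention on division.\<close>
  case True
  then show ?thesis using A W by (simp add: real_sqrt_mult)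
next
  case False
  then have T: "0 < T" using A by simp
  define k m X Y where "k = sqrt (A / T)" and "m = sqrt (1 - A / T)" and "X = sqrt T * p" and "Y = sqrt W * \<bar>q\<bar>"
  have km: "k\<^sup>2 + m\<^sup>2 = 1" using A T by (simp add: k_def m_def)
  have XY: "X\<^sup>2 + Y\<^sup>2 = T * \<bar>p\<bar>\<^sup>2 + W * \<bar>q\<bar>\<^sup>2" using T W by (simp add: X_def Y_def power_mult_distrib)
  \<comment> \<open>The added square completes Lagrange's identity.\<close>
  have "(k * X + m * Y)\<^sup>2 \<le> (k * X + m * Y)\<^sup>2 + (k * Y - m * X)\<^sup>2" by simp
  also have "\<dots> = (k\<^sup>2 + m\<^sup>2) * (X\<^sup>2 + Y\<^sup>2)" by (simp add: power2_eq_square algebra_simps)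
  finally have "k * X + m * Y \<le> sqrt (T * \<bar>p\<bar>\<^sup>2 + W * \<bar>q\<bar>\<^sup>2)"
    by (intro real_le_rsqrt) (simp add: km XY)
  moreover have "k * X = sqrt A * p" "m * Y = sqrt (W * (1 - A / T)) * \<bar>q\<bar>"
    using T by (simp_all add: k_def m_def X_def Y_def real_sqrt_divide real_sqrt_mult)
  ultimately show ?thesis by simp
qed

section \<open>Concavity from the monotonicity of \<open>\<Phi>\<close>\<close>

text \<open>The metric does not depend on \<open>u\<close>, so by Clairaut's relation \<theta> u' is
  constant along unit-speed geodesics. This constant is the parameter a or \<alpha> below, and
  \<open>reach \<alpha>\<close> is the u-distance covered from v = 1 down to the turning point and
  back. Continuity on the whole line supplies Borel measurability.\<close>

locale clairaut =
  fixes \<theta> w :: "real \<Rightarrow> real"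
  assumes \<theta>_cont: "continuous_on UNIV \<theta>" and w_cont: "continuous_on UNIV w"
    and \<theta>_mono: "strict_mono_on {0..1} \<theta>" and \<theta>_0: "\<theta> 0 = 0" and w_nonneg: "\<And>t. 0 \<le> w t"
begin

text \<open>
  \<open>reach\<close> is \<open>\<Phi>\<close> in the variable \<open>\<alpha> = \<theta>(x)\<^sup>1\<^sup>/\<^sup>2\<close>, and \<open>excess\<close> is the function \<open>H\<close> above.
\<close>

definition reach :: "real \<Rightarrow> ennreal" where
  "reach \<alpha> = 2 * (\<integral>\<^sup>+t. ennreal (\<alpha> * sqrt (w t / (\<theta> t * (\<theta> t - \<alpha>\<^sup>2)))) * indicator {t. 0 < t \<and> t < 1 \<and> \<alpha>\<^sup>2 < \<theta> t} t \<partial>lborel)"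

definition excess :: "real \<Rightarrow> ennreal" where
  "excess a = 2 * (\<integral>\<^sup>+t. ennreal (sqrt (w t * (1 - a\<^sup>2 / \<theta> t))) * indicator {t. 0 < t \<and> t < 1 \<and> a\<^sup>2 < \<theta> t} t \<partial>lborel)"

lemma \<theta>_less: "0 \<le> x \<Longrightarrow> x < y \<Longrightarrow> y \<le> 1 \<Longrightarrow> \<theta> x < \<theta> y"
  using \<theta>_mono by (auto simp: strict_mono_on_def)

lemma \<theta>_pos: "0 < t \<Longrightarrow> t \<le> 1 \<Longrightarrow> 0 < \<theta> t"
  using \<theta>_less[of 0 t] \<theta>_0 by simp

lemma \<theta>_nonneg: "0 \<le> t \<Longrightarrow> t \<le> 1 \<Longrightarrow> 0 \<le> \<theta> t"
  using \<theta>_pos[of t] \<theta>_0 by (cases "t = 0") auto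

lemma \<theta>_measurable [measurable]: "\<theta> \<in> borel_measurable borel"
  and w_measurable [measurable]: "w \<in> borel_measurable borel"
  using \<theta>_cont w_cont by (auto intro: borel_measurable_continuous_onI)

lemma reach_measurable [measurable]: "reach \<in> borel_measurable borel"
  unfolding reach_def by measurable

text \<open>The integrand is singular at \<open>sqrt T\<close>, but its primitive \<open>?F\<close>
  is continuous up to that endpoint and vanishes there.\<close>

lemma has_integral_reach_fibre:
  assumes a: "0 \<le> a" "a\<^sup>2 < T" and W: "0 \<le> W"
  shows "((\<lambda>\<alpha>. \<alpha> * sqrt (W / (T * (T - \<alpha>\<^sup>2)))) has_integral sqrt (W * (1 - a\<^sup>2 / T))) {a<..<sqrt T}"
proof -
  have T: "0 < T" using a by (smt (verit) zero_le_power2)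
  have aT: "a < sqrt T" using a by (simp add: real_less_rsqrt)
  let ?F = "\<lambda>\<alpha>. - sqrt (W / T) * sqrt (T - \<alpha>\<^sup>2)"
  have "((\<lambda>\<alpha>. \<alpha> * sqrt (W / (T * (T - \<alpha>\<^sup>2)))) has_integral (?F (sqrt T) - ?F a)) {a..sqrt T}"
  proof (rule fundamental_theorem_of_calculus_interior)
    show "continuous_on {a..sqrt T} ?F" by (intro continuous_intros)
    fix \<alpha> assume \<alpha>: "\<alpha> \<in> {a<..<sqrt T}"
    then have "0 < T - \<alpha>\<^sup>2" using a real_sqrt_less_iff[of "\<alpha>\<^sup>2" T] by simp
    then have "(?F has_real_derivative - sqrt (W / T) * (- \<alpha> / sqrt (T - \<alpha>\<^sup>2))) (at \<alpha>)"
      by (auto intro!: derivative_eq_intros simp: field_simps)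
    moreover have "- sqrt (W / T) * (- \<alpha> / sqrt (T - \<alpha>\<^sup>2)) = \<alpha> * sqrt (W / (T * (T - \<alpha>\<^sup>2)))"
      by (simp add: real_sqrt_mult real_sqrt_divide)
    ultimately show "(?F has_vector_derivative \<alpha> * sqrt (W / (T * (T - \<alpha>\<^sup>2)))) (at \<alpha>)"
      by (simp add: has_real_derivative_iff_has_vector_derivative)
  qed (use aT in simp)
  moreover have "?F (sqrt T) - ?F a = sqrt (W * (1 - a\<^sup>2 / T))"
  proof -
    have "W * (1 - a\<^sup>2 / T) = W / T * (T - a\<^sup>2)" using T by (simp add: field_simps)
    then show ?thesis using T by (simp add: real_sqrt_mult real_sqrt_divide)
  qed
  ultimately show ?thesis by (simp add: has_integral_Icc_iff_Ioo)
qed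

text \<open>Tonelli: for fixed \<open>t\<close> the constraints leave
  \<open>a < \<alpha> < sqrt (\<theta> t)\<close>, the range of the preceding lemma. The integral
  may run to infinity because \<open>reach \<alpha>\<close> is 0 once
  \<open>\<alpha> \<ge> sqrt (\<theta> 1)\<close>.\<close>

lemma nn_integral_reach:
  assumes a: "0 \<le> a"
  shows "(\<integral>\<^sup>+\<alpha>. reach \<alpha> * indicator {a<..} \<alpha> \<partial>lborel) = excess a"
proof -
  define f where "f t \<alpha> = ennreal (\<alpha> * sqrt (w t / (\<theta> t * (\<theta> t - \<alpha>\<^sup>2)))) *
     indicator {t. 0 < t \<and> t < 1 \<and> \<alpha>\<^sup>2 < \<theta> t} t * indicator {a<..} \<alpha>" for t \<alpha>
  have [measurable]: "case_prod f \<in> borel_measurable (lborel \<Otimes>\<^sub>M lborel)"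
    unfolding f_def[abs_def] split_beta' by measurable
  have fibre: "(\<integral>\<^sup>+\<alpha>. f t \<alpha> \<partial>lborel)
      = ennreal (sqrt (w t * (1 - a\<^sup>2 / \<theta> t))) * indicator {t. 0 < t \<and> t < 1 \<and> a\<^sup>2 < \<theta> t} t" for t
  proof (cases "0 < t \<and> t < 1 \<and> a\<^sup>2 < \<theta> t")
    case True
    have eq: "f t \<alpha> = ennreal (indicator {a<..<sqrt (\<theta> t)} \<alpha> * (\<alpha> * sqrt (w t / (\<theta> t * (\<theta> t - \<alpha>\<^sup>2)))))" for \<alpha>
    proof -
      have "\<alpha>\<^sup>2 < \<theta> t \<longleftrightarrow> \<alpha> < sqrt (\<theta> t)" if "a < \<alpha>"
        using that a real_sqrt_less_iff[of "\<alpha>\<^sup>2" "\<theta> t"] by simp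
      then show ?thesis using True by (auto simp: f_def indicator_def)
    qed
    have "(\<integral>\<^sup>+\<alpha>. f t \<alpha> \<partial>lborel) = ennreal (sqrt (w t * (1 - a\<^sup>2 / \<theta> t)))"
      unfolding eq
    proof (rule nn_integral_has_integral_lebesgue)
      show "0 \<le> \<alpha> * sqrt (w t / (\<theta> t * (\<theta> t - \<alpha>\<^sup>2)))" if "\<alpha> \<in> {a<..<sqrt (\<theta> t)}" for \<alpha>
      proof -
        have "\<alpha>\<^sup>2 < \<theta> t" using that a real_sqrt_less_iff[of "\<alpha>\<^sup>2" "\<theta> t"] by simp
        then show ?thesis using that a \<theta>_pos[of t] True w_nonneg[of t]
          by (intro mult_nonneg_nonneg real_sqrt_ge_zero divide_nonneg_nonneg) auto
      qed
    qed (use has_integral_reach_fibre[OF a _ w_nonneg] True in blast)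
    then show ?thesis using True by simp
  next
    case False
    have "f t \<alpha> = 0" for \<alpha>
    proof -
      have "a\<^sup>2 < \<theta> t" if "a < \<alpha>" "\<alpha>\<^sup>2 < \<theta> t"
        using power_mono[of a \<alpha> 2] that a by linarith
      then show ?thesis using False by (auto simp: f_def indicator_def)
    qed
    then show ?thesis using False by simp
  qed
  have "(\<integral>\<^sup>+\<alpha>. reach \<alpha> * indicator {a<..} \<alpha> \<partial>lborel) = (\<integral>\<^sup>+\<alpha>. 2 * (\<integral>\<^sup>+t. f t \<alpha> \<partial>lborel) \<partial>lborel)"
    unfolding reach_def f_def by (simp add: nn_integral_multc[symmetric] mult.assoc)
  also have "\<dots> = 2 * (\<integral>\<^sup>+\<alpha>. (\<integral>\<^sup>+t. f t \<alpha> \<partial>lborel) \<partial>lborel)"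
    by (intro nn_integral_cmult) measurable
  also have "\<dots> = excess a"
    by (subst lborel_pair.Fubini') (simp_all add: fibre excess_def)
  finally show ?thesis .
qed

text \<open>The link with \<open>Phi\<close>: strict monotonicity turns
  \<open>\<theta> x < \<theta> t\<close> into \<open>x < t\<close>, and the factor
  \<open>sqrt (\<theta> x)\<close> moves under the root.\<close>

lemma reach_sqrt_\<theta>:
  assumes x: "0 < x" "x < 1"
  shows "reach (sqrt (\<theta> x)) = 2 * (\<integral>\<^sup>+t. ennreal (sqrt (\<theta> x * w t / (\<theta> t * (\<theta> t - \<theta> x)))) \<partial>lebesgue_on {x<..<1})"
proof -
  have [simp]: "(sqrt (\<theta> x))\<^sup>2 = \<theta> x" using \<theta>_nonneg[of x] x by simp
  have "\<theta> x < \<theta> t \<longleftrightarrow> x < t" if "0 < t" "t < 1" for t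
    using \<theta>_less[of x t] \<theta>_less[of t x] x that by (cases x t rule: linorder_cases) auto
  then have "{t. 0 < t \<and> t < 1 \<and> \<theta> x < \<theta> t} = {x<..<1}" using x by auto
  then show ?thesis
    unfolding reach_def
    by (simp add: nn_integral_restrict_space nn_integral_completion times_divide_eq_right[symmetric] real_sqrt_mult
          del: times_divide_eq_right)
qed

text \<open>For \<open>c = 0\<close> the quotient \<open>\<theta> c / \<theta> t\<close> is \<open>0\<close> also at \<open>t = 0\<close>, because \<open>0 / 0 = 0\<close>.\<close>

lemma excess_sqrt_\<theta>:
  assumes c: "0 \<le> c" "c \<le> 1"
  defines "G \<equiv> \<lambda>t. sqrt (w t * (1 - \<theta> c / \<theta> t))"
  shows "continuous_on {c..1} G" "excess (sqrt (\<theta> c)) = ennreal (2 * integral {c..1} G)"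
proof -
  show cont: "continuous_on {c..1} G"
  proof (cases "c = 0")
    case True
    then show ?thesis unfolding G_def
      by (auto simp: \<theta>_0 intro!: continuous_intros continuous_on_subset[OF w_cont])
  next
    case False
    have "\<theta> t \<noteq> 0" if "t \<in> {c..1}" for t using \<theta>_pos[of t] that False c by auto
    then show ?thesis unfolding G_def
      by (auto intro!: continuous_intros continuous_on_subset[OF w_cont] continuous_on_subset[OF \<theta>_cont])
  qed
  have [simp]: "(sqrt (\<theta> c))\<^sup>2 = \<theta> c" using \<theta>_nonneg[of c] c by simp
  have "\<theta> c < \<theta> t \<longleftrightarrow> c < t" if "0 < t" "t < 1" for t
    using \<theta>_less[of c t] \<theta>_less[of t c] c that by (cases c t rule: linorder_cases) auto
  then have set_eq: "{t. 0 < t \<and> t < 1 \<and> \<theta> c < \<theta> t} = {c<..<1}" using c by auto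
  have G_nonneg: "0 \<le> G t" if "t \<in> {c<..<1}" for t
    unfolding G_def using \<theta>_less[of c t] \<theta>_pos[of t] that c w_nonneg[of t]
    by (intro real_sqrt_ge_zero mult_nonneg_nonneg) auto
  have "(G has_integral integral {c..1} G) {c<..<1}"
    using cont by (simp add: integrable_integral integrable_continuous_real flip: has_integral_Icc_iff_Ioo)
  from nn_integral_has_integral_lebesgue[OF G_nonneg this]
  have "(\<integral>\<^sup>+t. ennreal (G t) * indicator {c<..<1} t \<partial>lborel) = ennreal (integral {c..1} G)"
    by (simp add: ennreal_mult'' ennreal_indicator mult.commute)
  then show "excess (sqrt (\<theta> c)) = ennreal (2 * integral {c..1} G)"
    unfolding excess_def by (simp add: set_eq ennreal_mult' G_def)
qed

text \<open>Concavity enters through two chords only. Since \<open>reach\<close> is non-decreasing,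
  \<open>excess\<close> falls by at most \<open>a * reach a\<close> from 0 to \<open>a\<close>, and
  by at least \<open>(\<sigma> - a) * reach a\<close> from \<open>a\<close> to
  \<open>\<sigma>\<close>. Comparing \<open>reach a\<close> with \<open>s\<close> then decides which
  end of the range does at least as well as \<open>a\<close>.\<close>

lemma excess_tangent_bound:
  assumes mono: "mono_on {0<..<1} (\<lambda>x. 2 * (\<integral>\<^sup>+t. ennreal (sqrt (\<theta> x * w t / (\<theta> t * (\<theta> t - \<theta> x)))) \<partial>lebesgue_on {x<..<1}))"
    and c: "0 \<le> c" "c \<le> 1" and s: "0 \<le> s"
  shows "min (ennreal (sqrt (\<theta> 1) * s)) (excess 0) \<le> ennreal (sqrt (\<theta> c) * s) + excess (sqrt (\<theta> c))"
proof -
  consider "c = 0" | "c = 1" | "0 < c" "c < 1" using c by linarith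
  then show ?thesis
  proof cases
    case 3
    define a \<sigma> where "a = sqrt (\<theta> c)" and "\<sigma> = sqrt (\<theta> 1)"
    have a: "0 < a" "a < \<sigma>" using \<theta>_pos[of c] \<theta>_less[of c 1] 3 by (auto simp: a_def \<sigma>_def)
    have reach_mono: "reach \<alpha> \<le> reach \<beta>" if \<alpha>\<beta>: "0 < \<alpha>" "\<alpha> \<le> \<beta>" "\<beta> < \<sigma>" for \<alpha> \<beta>
    proof -
      \<comment> \<open>Each level strictly between 0 and \<open>\<sigma>\<close> is
        \<open>sqrt (\<theta> x)\<close> for an interior \<open>x\<close>, so the monotonicity of
        \<Phi> carries over to \<open>reach\<close>.\<close>
      have root: "\<exists>x. 0 < x \<and> x < 1 \<and> \<gamma> = sqrt (\<theta> x)" if \<gamma>: "0 < \<gamma>" "\<gamma> < \<sigma>" for \<gamma>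
      proof -
        have "\<gamma>\<^sup>2 < \<sigma>\<^sup>2" using \<gamma> by (simp add: power_strict_mono)
        then have "\<gamma>\<^sup>2 < \<theta> 1" using \<theta>_nonneg[of 1] by (simp add: \<sigma>_def)
        moreover obtain x where x: "0 \<le> x" "x \<le> 1" "\<theta> x = \<gamma>\<^sup>2"
          using IVT'[of \<theta> 0 "\<gamma>\<^sup>2" 1] calculation \<theta>_0 continuous_on_subset[OF \<theta>_cont] by auto
        ultimately have "x \<noteq> 0" "x \<noteq> 1" using \<theta>_0 \<gamma> by auto
        then show ?thesis using x \<gamma> by (intro exI[of _ x]) auto
      qed
      obtain x y where xy: "0 < x" "x < 1" "\<alpha> = sqrt (\<theta> x)" "0 < y" "y < 1" "\<beta> = sqrt (\<theta> y)"
        using root[of \<alpha>] root[of \<beta>] \<alpha>\<beta> by auto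
      then have "x \<le> y" using \<theta>_less[of y x] \<alpha>\<beta> by (cases "x \<le> y") auto
      then show ?thesis using mono_onD[OF mono, of x y] xy reach_sqrt_\<theta> by simp
    qed
    have right: "reach a * ennreal (\<sigma> - a) \<le> excess a"
    proof -
      have "reach a * ennreal (\<sigma> - a) = (\<integral>\<^sup>+\<alpha>. reach a * indicator {a<..<\<sigma>} \<alpha> \<partial>lborel)"
        using a by (simp add: nn_integral_cmult)
      also have "\<dots> \<le> (\<integral>\<^sup>+\<alpha>. reach \<alpha> * indicator {a<..} \<alpha> \<partial>lborel)"
        using reach_mono[of a] a by (intro nn_integral_mono) (auto simp: indicator_def)
      finally show ?thesis using nn_integral_reach[of a] a by simp
    qed
    have left: "excess 0 \<le> reach a * ennreal a + excess a"
    proof -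
      have "excess 0 = (\<integral>\<^sup>+\<alpha>. reach \<alpha> * indicator {0<..a} \<alpha> + reach \<alpha> * indicator {a<..} \<alpha> \<partial>lborel)"
        using a by (subst nn_integral_reach[symmetric]) (auto intro!: nn_integral_cong simp: indicator_def)
      also have "\<dots> = (\<integral>\<^sup>+\<alpha>. reach \<alpha> * indicator {0<..a} \<alpha> \<partial>lborel) + excess a"
        using a by (subst nn_integral_add) (auto simp: nn_integral_reach)
      also have "(\<integral>\<^sup>+\<alpha>. reach \<alpha> * indicator {0<..a} \<alpha> \<partial>lborel) \<le> (\<integral>\<^sup>+\<alpha>. reach a * indicator {0<..a} \<alpha> \<partial>lborel)"
        using reach_mono[of _ a] a by (intro nn_integral_mono) (auto simp: indicator_def)
      also have "\<dots> = reach a * ennreal a" using a by (simp add: nn_integral_cmult)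
      finally show ?thesis by (simp add: add_right_mono)
    qed
    show ?thesis
    \<comment> \<open>In the first case the end 0 wins, by \<open>left\<close>; in the second the
      end \<open>\<sigma>\<close> wins, by \<open>right\<close>.\<close>
    proof (cases "reach a \<le> ennreal s")
      case True
      then have "excess 0 \<le> ennreal s * ennreal a + excess a"
        using left by (meson add_right_mono mult_right_mono order_trans zero_le)
      then show ?thesis using s a by (simp add: min.coboundedI2 ennreal_mult' mult.commute flip: a_def)
    next
      case False
      then have "ennreal s * ennreal (\<sigma> - a) \<le> excess a"
        using right by (meson mult_right_mono order_trans zero_le nle_le)
      then have "ennreal (a * s) + ennreal s * ennreal (\<sigma> - a) \<le> ennreal (a * s) + excess a"
        by (rule add_left_mono)
      moreover have "ennreal (a * s) + ennreal s * ennreal (\<sigma> - a) = ennreal (\<sigma> * s)"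
        using s a by (simp flip: ennreal_mult' ennreal_plus) (simp add: algebra_simps)
      ultimately show ?thesis by (simp add: min.coboundedI1 flip: a_def \<sigma>_def)
    qed
  qed (simp_all add: \<theta>_0 min.coboundedI1)
qed

end

section \<open>Lengths of curves\<close>

text \<open>The competitor through v = 0, in three equal phases: \<open>descent\<close> takes v from
  1 to 0, then \<open>ramp\<close> moves u from 0 to s at no cost because \<theta> vanishes at 0,
  and finally v climbs back to 1.\<close>

definition descent :: "real \<Rightarrow> real" where
  "descent x = max 0 (max (1 - 3 * x) (3 * x - 2))"
definition descent' :: "real \<Rightarrow> real" where
  "descent' x = (if x < 1/3 then -3 else if x \<le> 2/3 then 0 else 3)"
definition ramp :: "real \<Rightarrow> real \<Rightarrow> real" where
  "ramp s x = s * max 0 (min 1 (3 * x - 1))"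
definition ramp' :: "real \<Rightarrow> real \<Rightarrow> real" where
  "ramp' s x = (if x < 1/3 then 0 else if x \<le> 2/3 then 3 * s else 0)"

lemma has_real_derivative_eq_near:
  assumes "open U" "x \<in> U" "\<And>y. y \<in> U \<Longrightarrow> f y = A * y + B"
  shows "(f has_real_derivative A) (at x)"
proof -
  have "((\<lambda>y. A * y + B) has_real_derivative A) (at x)" by (auto intro!: derivative_eq_intros)
  then show ?thesis by (rule has_field_derivative_transform_within_open[OF _ assms(1,2)]) (simp add: assms(3))
qed

lemma H1_unit_descent: "H1_unit descent descent'"
proof (rule H1_unit_piecewiseI)
  show "continuous_on {0..1} descent" unfolding descent_def by (intro continuous_intros)
  show "finite {1/3, 2/3::real}" by simp
  show "\<bar>descent' x\<bar> \<le> 3" for x by (simp add: descent'_def)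
  show "descent' \<in> borel_measurable borel" unfolding descent'_def by measurable
  fix x :: real assume "x \<in> {0<..<1} - {1/3, 2/3}"
  then consider "x < 1/3" | "1/3 < x" "x < 2/3" | "2/3 < x" by fastforce
  then show "(descent has_real_derivative descent' x) (at x)"
  proof cases
    case 1
    then show ?thesis by (intro has_real_derivative_eq_near[where U = "{..<1/3}" and B = 1]) (auto simp: descent_def descent'_def)
  next
    case 2
    then show ?thesis by (intro has_real_derivative_eq_near[where U = "{1/3<..<2/3}" and B = 0]) (auto simp: descent_def descent'_def)
  next
    case 3
    then show ?thesis by (intro has_real_derivative_eq_near[where U = "{2/3<..}" and B = "-2"]) (auto simp: descent_def descent'_def)
  qed
qed

lemma H1_unit_ramp: "H1_unit (ramp s) (ramp' s)"
proof (rule H1_unit_piecewiseI)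
  show "continuous_on {0..1} (ramp s)" unfolding ramp_def by (intro continuous_intros)
  show "finite {1/3, 2/3::real}" by simp
  show "\<bar>ramp' s x\<bar> \<le> 3 * \<bar>s\<bar>" for x by (simp add: ramp'_def abs_mult)
  show "ramp' s \<in> borel_measurable borel" unfolding ramp'_def by measurable
  fix x :: real assume "x \<in> {0<..<1} - {1/3, 2/3}"
  then consider "x < 1/3" | "1/3 < x" "x < 2/3" | "2/3 < x" by fastforce
  then show "(ramp s has_real_derivative ramp' s x) (at x)"
  proof cases
    case 1
    then show ?thesis by (intro has_real_derivative_eq_near[where U = "{..<1/3}" and B = 0]) (auto simp: ramp_def ramp'_def)
  next
    case 2
    then show ?thesis by (intro has_real_derivative_eq_near[where U = "{1/3<..<2/3}" and B = "-s"]) (auto simp: ramp_def ramp'_def algebra_simps)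
  next
    case 3
    then show ?thesis by (intro has_real_derivative_eq_near[where U = "{2/3<..}" and B = s]) (auto simp: ramp_def ramp'_def)
  qed
qed

section \<open>Lower bound, two competitors, and the infimum\<close>

context clairaut
begin

abbreviation speed :: "(real \<Rightarrow> real) \<Rightarrow> (real \<Rightarrow> real) \<Rightarrow> (real \<Rightarrow> real) \<Rightarrow> real \<Rightarrow> ennreal" where
  "speed u' v v' x \<equiv> ennreal (sqrt (\<theta> (v x) * \<bar>u' x\<bar>\<^sup>2 + w (v x) * \<bar>v' x\<bar>\<^sup>2))"

text \<open>The constant \<open>c\<close> is the minimum of \<open>v\<close> on the curve. The
  u-part of the calibration integrates to \<open>sqrt (\<theta> c) * s\<close>; the v-part is
  estimated separately on the two sides of a minimum point \<open>p\<close>.\<close>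

lemma length_ge:
  assumes H: "H1_unit u u'" "H1_unit v v'" and cont: "continuous_on {0..1} u" "continuous_on {0..1} v"
    and bdry: "u 0 = 0" "u 1 = s" "v 0 = 1" "v 1 = 1" and range: "\<And>x. x \<in> {0..1} \<Longrightarrow> 0 \<le> v x \<and> v x \<le> 1"
  obtains c where "0 \<le> c" "c \<le> 1"
    "ennreal (sqrt (\<theta> c) * s + 2 * integral {c..1} (\<lambda>t. sqrt (w t * (1 - \<theta> c / \<theta> t)))) \<le> (\<integral>\<^sup>+x. speed u' v v' x \<partial>unit_lebesgue)"
proof -
  obtain p where p: "p \<in> {0..1}" "\<And>x. x \<in> {0..1} \<Longrightarrow> v p \<le> v x"
    using continuous_attains_inf[OF _ _ cont(2)] by auto
  define c where "c = v p"
  have c: "0 \<le> c" "c \<le> 1" using range p(1) by (auto simp: c_def)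
  define G where "G t = sqrt (w t * (1 - \<theta> c / \<theta> t))" for t
  have G: "continuous_on {c..1} G" unfolding G_def by (rule excess_sqrt_\<theta>(1)[OF c])
  have \<theta>_le: "\<theta> c \<le> \<theta> t" if "t \<in> {c..1}" for t
    using \<theta>_less[of c t] that c by (cases "c = t") auto
  have G_nonneg: "0 \<le> G t" if "t \<in> {c..1}" for t
  proof -
    \<comment> \<open>If \<open>\<theta> t = 0\<close>, the quotient is 0 by convention.\<close>
    have "\<theta> c / \<theta> t \<le> 1"
      using \<theta>_le[OF that] \<theta>_nonneg[of t] that c by (cases "\<theta> t = 0") (auto simp: divide_le_eq_1)
    then show ?thesis unfolding G_def using w_nonneg[of t] by simp
  qed
  have v_range: "v x \<in> {c..1}" if "x \<in> {0..1}" for x using p(2) range that by (auto simp: c_def)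
  have u': "u' absolutely_integrable_on {0..1}" and v': "v' absolutely_integrable_on {0..1}"
    using H L2_unit_absolutely_integrable by (auto simp: H1_unit_def)
  then have av': "(\<lambda>x. \<bar>v' x\<bar>) absolutely_integrable_on {0..1}" by (simp add: absolutely_integrable_on_def)
  have Gv: "(\<lambda>x. G (v x) * \<bar>v' x\<bar>) absolutely_integrable_on {0..1}"
    using v_range by (intro absolutely_integrable_continuous_mult continuous_on_compose2[OF G cont(2)] av') auto
  have au': "(\<lambda>x. sqrt (\<theta> c) * u' x) absolutely_integrable_on {0..1}"
    by (intro absolutely_integrable_continuous_mult u' continuous_intros)
  have half: "\<bar>integral {c..v y} G - integral {c..v x} G\<bar> \<le> integral {x..y} (\<lambda>x. G (v x) * \<bar>v' x\<bar>)"
    if "0 \<le> x" "x \<le> y" "y \<le> 1" for x y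
  proof (rule integral_chain_rule_le[where d = 1])
    show "v' absolutely_integrable_on {x..y}"
      using that by (intro absolutely_integrable_on_subinterval[OF v']) auto
    show "continuous_on {x..y} v" using that by (intro continuous_on_subset[OF cont(2)]) auto
    show "integral {a..b} v' = v b - v a" if "x \<le> a" "a \<le> b" "b \<le> y" for a b
      using that \<open>0 \<le> x\<close> \<open>y \<le> 1\<close> by (intro H1_unit_ftc[OF H(2) cont(2)]) auto
  qed (use that G G_nonneg v_range in auto)
  \<comment> \<open>Both halves join the value 1 to the value \<open>c\<close>, so each contributes
    at least one copy of the integral of \<open>G\<close>.\<close>
  have "2 * integral {c..1} G \<le> integral {0..p} (\<lambda>x. G (v x) * \<bar>v' x\<bar>) + integral {p..1} (\<lambda>x. G (v x) * \<bar>v' x\<bar>)"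
    using half[of 0 p] half[of p 1] p(1) bdry by (simp flip: c_def)
  also have "\<dots> = integral {0..1} (\<lambda>x. G (v x) * \<bar>v' x\<bar>)"
    using p(1) Gv by (intro Henstock_Kurzweil_Integration.integral_combine) (auto simp: absolutely_integrable_on_def)
  finally have "sqrt (\<theta> c) * s + 2 * integral {c..1} G \<le> integral {0..1} (\<lambda>x. sqrt (\<theta> c) * u' x + G (v x) * \<bar>v' x\<bar>)"
    using H1_unit_ftc[OF H(1) cont(1), of 0 1] bdry Gv au'
    by (subst Henstock_Kurzweil_Integration.integral_add) (auto simp: absolutely_integrable_on_def)
  also have "\<dots> = (LINT x|unit_lebesgue. sqrt (\<theta> c) * u' x + G (v x) * \<bar>v' x\<bar>)"
    by (intro unit_lebesgue_integral_eq[symmetric] set_integral_add au' Gv)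
  finally have "ennreal (sqrt (\<theta> c) * s + 2 * integral {c..1} G) \<le> ennreal (LINT x|unit_lebesgue. sqrt (\<theta> c) * u' x + G (v x) * \<bar>v' x\<bar>)"
    by (rule ennreal_leI)
  also have "\<dots> \<le> (\<integral>\<^sup>+x. ennreal (sqrt (\<theta> c) * u' x + G (v x) * \<bar>v' x\<bar>) \<partial>unit_lebesgue)"
    using set_integral_add(1)[OF au' Gv] by (intro ennreal_integral_le_nn_integral) (simp add: absolutely_integrable_on_01_iff)
  also have "\<dots> \<le> (\<integral>\<^sup>+x. speed u' v v' x \<partial>unit_lebesgue)"
  proof (intro nn_integral_mono ennreal_leI)
    fix x assume "x \<in> space unit_lebesgue"
    then have "v x \<in> {c..1}" using v_range by auto
    then show "sqrt (\<theta> c) * u' x + G (v x) * \<bar>v' x\<bar> \<le> sqrt (\<theta> (v x) * \<bar>u' x\<bar>\<^sup>2 + w (v x) * \<bar>v' x\<bar>\<^sup>2)"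
      unfolding G_def using \<theta>_le \<theta>_nonneg[OF c] w_nonneg by (intro calibration_bound) auto
  qed
  finally show thesis using that[OF c] unfolding G_def by blast
qed

text \<open>On the outer thirds u is at rest, and the speed is, up to sign, the derivative of
  \<Gamma> composed with v. Each of them contributes \<Gamma> 1, and the middle third contributes
  nothing.\<close>

lemma length_descent:
  "(\<integral>\<^sup>+x. speed (ramp' s) descent descent' x \<partial>unit_lebesgue) = ennreal (2 * integral {0..1} (\<lambda>t. sqrt (w t)))"
proof -
  define \<Gamma> where "\<Gamma> z = integral {0..z} (\<lambda>t. sqrt (w t))" for z
  have sqrt_w: "continuous_on S (\<lambda>t. sqrt (w t))" for S
    using continuous_on_subset[OF w_cont] by (intro continuous_intros) auto
  have \<Gamma>_cont: "continuous_on {0..1} \<Gamma>"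
    unfolding \<Gamma>_def by (intro indefinite_integral_continuous_1 integrable_continuous_real sqrt_w)
  have \<Gamma>_deriv: "(\<Gamma> has_real_derivative sqrt (w z)) (at z)" if "0 < z" "z < 1" for z
  proof -
    have "(\<Gamma> has_real_derivative sqrt (w z)) (at z within {0..1})"
      unfolding \<Gamma>_def using that by (intro integral_has_real_derivative sqrt_w) auto
    then show ?thesis using that at_within_Icc_at[of 0 z 1] by simp
  qed
  define h where "h x = sqrt (\<theta> (descent x) * \<bar>ramp' s x\<bar>\<^sup>2 + w (descent x) * \<bar>descent' x\<bar>\<^sup>2)" for x
  have h1: "(h has_integral (\<Gamma> 1)) {0..1/3}"
  proof -
    have "(h has_integral (- \<Gamma> (1 - 3 * (1/3)) - (- \<Gamma> (1 - 3 * 0)))) {0..1/3}"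
    proof (rule fundamental_theorem_of_calculus_interior)
      show "continuous_on {0..1/3} (\<lambda>x. - \<Gamma> (1 - 3 * x))"
        by (intro continuous_intros continuous_on_compose2[OF \<Gamma>_cont]) auto
      fix x :: real assume x: "x \<in> {0<..<1/3}"
      have "((\<lambda>x. 1 - 3 * x) has_real_derivative -3) (at x)" by (auto intro!: derivative_eq_intros)
      from DERIV_minus[OF DERIV_chain2[OF \<Gamma>_deriv this]] x
      have "((\<lambda>x. - \<Gamma> (1 - 3 * x)) has_real_derivative 3 * sqrt (w (1 - 3 * x))) (at x)" by (simp add: mult.commute)
      moreover have "h x = 3 * sqrt (w (1 - 3 * x))"
        using x by (simp add: h_def descent_def descent'_def ramp'_def real_sqrt_mult)
      ultimately show "((\<lambda>x. - \<Gamma> (1 - 3 * x)) has_vector_derivative h x) (at x)"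
        by (simp add: has_real_derivative_iff_has_vector_derivative)
    qed simp
    then show ?thesis by (simp add: \<Gamma>_def)
  qed
  \<comment> \<open>The integrand vanishes also at 1/3 and 2/3, because \<open>descent'\<close> is
    set to 0 at these two points.\<close>
  have h2: "(h has_integral 0) {1/3..2/3}"
    by (rule has_integral_is_0) (auto simp: h_def descent_def descent'_def \<theta>_0)
  have h3: "(h has_integral (\<Gamma> 1)) {2/3..1}"
  proof -
    have "(h has_integral (\<Gamma> (3 * 1 - 2) - \<Gamma> (3 * (2/3) - 2))) {2/3..1}"
    proof (rule fundamental_theorem_of_calculus_interior)
      show "continuous_on {2/3..1} (\<lambda>x. \<Gamma> (3 * x - 2))"
        by (intro continuous_intros continuous_on_compose2[OF \<Gamma>_cont]) auto
      fix x :: real assume x: "x \<in> {2/3<..<1}"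
      have "((\<lambda>x. 3 * x - 2) has_real_derivative 3) (at x)" by (auto intro!: derivative_eq_intros)
      from DERIV_chain2[OF \<Gamma>_deriv this] x
      have "((\<lambda>x. \<Gamma> (3 * x - 2)) has_real_derivative 3 * sqrt (w (3 * x - 2))) (at x)" by (simp add: mult.commute)
      moreover have "h x = 3 * sqrt (w (3 * x - 2))"
        using x by (simp add: h_def descent_def descent'_def ramp'_def real_sqrt_mult)
      ultimately show "((\<lambda>x. \<Gamma> (3 * x - 2)) has_vector_derivative h x) (at x)"
        by (simp add: has_real_derivative_iff_has_vector_derivative)
    qed simp
    then show ?thesis by (simp add: \<Gamma>_def)
  qed
  have "(h has_integral (\<Gamma> 1 + 0 + \<Gamma> 1)) {0..1}"
    by (rule has_integral_combine[OF _ _ has_integral_combine[OF _ _ h1 h2] h3]) auto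
  then have "(h has_integral (2 * \<Gamma> 1)) {0<..<1}" by (simp flip: has_integral_Icc_iff_Ioo)
  moreover have "0 \<le> h x" if "x \<in> {0<..<1}" for x
    unfolding h_def using w_nonneg \<theta>_nonneg[of "descent x"] that
    by (intro real_sqrt_ge_zero add_nonneg_nonneg mult_nonneg_nonneg) (auto simp: descent_def)
  ultimately have "(\<integral>\<^sup>+x. ennreal (indicator {0<..<1} x * h x) \<partial>lborel) = ennreal (2 * \<Gamma> 1)"
    by (intro nn_integral_has_integral_lebesgue) auto
  then show ?thesis
    unfolding h_def \<Gamma>_def
    by (simp add: nn_integral_restrict_space nn_integral_completion ennreal_mult' ennreal_indicator mult.commute)
qed

lemma length_straight:
  "0 \<le> s \<Longrightarrow> (\<integral>\<^sup>+x. speed (\<lambda>x. s) (\<lambda>x. 1) (\<lambda>x. 0) x \<partial>unit_lebesgue) = ennreal (sqrt (\<theta> 1) * s)"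
  by (simp add: real_sqrt_mult emeasure_restrict_space)

text \<open>The calibration bound at the minimal value \<open>c\<close> of each curve, combined with
  \<open>excess_tangent_bound\<close>, gives the lower bound. Both candidates for the minimum are
  lengths of admissible curves.\<close>

lemma Inf_length:
  assumes mono: "mono_on {0<..<1} (\<lambda>x. 2 * (\<integral>\<^sup>+t. ennreal (sqrt (\<theta> x * w t / (\<theta> t * (\<theta> t - \<theta> x)))) \<partial>lebesgue_on {x<..<1}))"
    and s: "0 \<le> s"
  shows "Inf {(\<integral>\<^sup>+x. speed u' v v' x \<partial>unit_lebesgue) | u u' v v'. H1_unit u u' \<and> H1_unit v v' \<and>
            continuous_on {0..1} u \<and> continuous_on {0..1} v \<and> u 0 = 0 \<and> u 1 = s \<and>
            (\<forall>x\<in>{0..1}. 0 \<le> v x \<and> v x \<le> 1) \<and> v 0 = 1 \<and> v 1 = 1}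
    = min (ennreal (sqrt (\<theta> 1) * s)) (ennreal (2 * integral {0..1} (\<lambda>t. sqrt (w t))))" (is "Inf ?L = min ?a ?b")
proof (rule antisym)
  show "min ?a ?b \<le> Inf ?L"
  proof (rule Inf_greatest)
    fix L assume "L \<in> ?L"
    then obtain u u' v v' where L: "L = (\<integral>\<^sup>+x. speed u' v v' x \<partial>unit_lebesgue)"
      and *: "H1_unit u u'" "H1_unit v v'" "continuous_on {0..1} u" "continuous_on {0..1} v"
        "u 0 = 0" "u 1 = s" "v 0 = 1" "v 1 = 1" "\<And>x. x \<in> {0..1} \<Longrightarrow> 0 \<le> v x \<and> v x \<le> 1" by auto
    obtain c where c: "0 \<le> c" "c \<le> 1"
      and ge: "ennreal (sqrt (\<theta> c) * s + 2 * integral {c..1} (\<lambda>t. sqrt (w t * (1 - \<theta> c / \<theta> t)))) \<le> L"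
      unfolding L by (rule length_ge[OF *])
    \<comment> \<open>At \<open>c = 0\<close> the factor \<open>1 - \<theta> c / \<theta> t\<close>
      is 1.\<close>
    have "?b = excess 0" using excess_sqrt_\<theta>(2)[of 0] by (simp add: \<theta>_0)
    then have "min ?a ?b \<le> ennreal (sqrt (\<theta> c) * s) + ennreal (2 * integral {c..1} (\<lambda>t. sqrt (w t * (1 - \<theta> c / \<theta> t))))"
      using excess_tangent_bound[OF mono c s] excess_sqrt_\<theta>(2)[OF c] by simp
    also have "\<dots> = ennreal (sqrt (\<theta> c) * s + 2 * integral {c..1} (\<lambda>t. sqrt (w t * (1 - \<theta> c / \<theta> t))))"
    proof (rule ennreal_plus[symmetric])
      show "0 \<le> sqrt (\<theta> c) * s" using \<theta>_nonneg[OF c] s by simp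
      have "0 \<le> sqrt (w t * (1 - \<theta> c / \<theta> t))" if "t \<in> {c..1}" for t
        using \<theta>_less[of c t] \<theta>_nonneg[of t] that c w_nonneg[of t]
        by (cases "c = t"; cases "\<theta> t = 0") (auto intro!: mult_nonneg_nonneg simp: divide_le_eq_1)
      then show "0 \<le> 2 * integral {c..1} (\<lambda>t. sqrt (w t * (1 - \<theta> c / \<theta> t)))"
        using excess_sqrt_\<theta>(1)[OF c] by (intro mult_nonneg_nonneg integral_nonneg integrable_continuous_real) auto
    qed
    finally show "min ?a ?b \<le> L" using ge by (rule order_trans)
  qed
  show "Inf ?L \<le> min ?a ?b"
  proof (rule min.boundedI)
    have L_I: "(\<integral>\<^sup>+x. speed u' v v' x \<partial>unit_lebesgue) \<in> ?L"
      if "H1_unit u u'" "H1_unit v v'" "continuous_on {0..1} u" "continuous_on {0..1} v" "u 0 = 0" "u 1 = s"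
        "\<And>x. x \<in> {0..1} \<Longrightarrow> 0 \<le> v x \<and> v x \<le> 1" "v 0 = 1" "v 1 = 1" for u u' v v'
      unfolding mem_Collect_eq 
      by (rule exI[of _ u], rule exI[of _ u'], rule exI[of _ v], rule exI[of _ v']) (use that in simp)
    have "?a \<in> ?L"
      unfolding length_straight[OF s, symmetric]
    proof (rule L_I)
      show "H1_unit (\<lambda>x. s * x) (\<lambda>x. s)" "H1_unit (\<lambda>x. 1) (\<lambda>x. 0)"
        using H1_unit_linear[of s 0] H1_unit_linear[of 0 1] by simp_all
    qed (auto intro!: continuous_intros)
    then show "Inf ?L \<le> ?a" by (rule Inf_lower)
    have "?b \<in> ?L"
      unfolding length_descent[of s, symmetric]
    proof (rule L_I[OF H1_unit_ramp H1_unit_descent])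
      show "continuous_on {0..1} (ramp s)" "continuous_on {0..1} descent"
        unfolding ramp_def descent_def by (intro continuous_intros)+
    qed (auto simp: ramp_def descent_def)
    then show "Inf ?L \<le> ?b" by (rule Inf_lower)
  qed
qed

end

section \<open>The function \<open>\<vartheta>\<close> of regular data\<close>

text \<open>Near 1, \<open>theta0\<close> is the square of
  \<open>sqrt (\<omega> (1 - t) / Q (1 - t))\<close> times \<open>l t\<close>, and
  \<open>l t\<close> tends to 1. The limit is first taken in \<open>[0,\<infinity>]\<close>;
  finiteness of its value \<open>L * L\<close> then makes \<open>L\<close> a real number.\<close>

lemma theta_at_1_limit:
  assumes reg: "regular_data l Q \<omega> \<phi>" and fin: "theta_at1 l Q \<omega> < \<infinity>"
  obtains \<sigma> where "0 \<le> \<sigma>" "sigma_bar Q \<omega> = ennreal \<sigma>" "theta l Q \<omega> 1 = \<sigma>\<^sup>2"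
    "((\<lambda>t. theta0 l Q \<omega> t) \<longlongrightarrow> \<sigma>\<^sup>2) (at_left 1)"
proof -
  obtain L :: ennreal where L: "((\<lambda>t. ennreal (sqrt (\<omega> t / Q t))) \<longlongrightarrow> L) (at_right 0)"
    using reg by (auto simp: regular_data_def)
  have sigma: "sigma_bar Q \<omega> = L" unfolding sigma_bar_def using L by (intro tendsto_Lim) auto
  have nonneg: "0 \<le> \<omega> t" "0 \<le> Q t" "0 \<le> l t" if "t \<in> {0..1}" for t
    using reg that by (auto simp: regular_data_def)
  have near: "\<forall>\<^sub>F t in at_left 1. t \<in> {0<..<1::real}"
    using eventually_at_left_real[of 0 1] by simp
  have "filterlim (\<lambda>t::real. 1 - t) (at_right 0) (at_left 1)"
    unfolding filterlim_at
  proof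
    show "\<forall>\<^sub>F t in at_left 1. 1 - t \<in> {0<..} \<and> 1 - t \<noteq> (0::real)"
      using near by eventually_elim auto
    have "((\<lambda>t::real. 1 - t) \<longlongrightarrow> 1 - 1) (at_left 1)" by (intro tendsto_intros)
    then show "((\<lambda>t::real. 1 - t) \<longlongrightarrow> 0) (at_left 1)" by simp
  qed
  from filterlim_compose[OF L this]
  have L1: "((\<lambda>t. ennreal (sqrt (\<omega> (1 - t) / Q (1 - t)))) \<longlongrightarrow> L) (at_left 1)" .
  have "continuous_on {0..1} l" "l 1 = 1" using reg by (auto simp: regular_data_def)
  then have "(l \<longlongrightarrow> 1) (at_left 1)"
    using at_within_Icc_at_left[of 0 "1::real"] unfolding continuous_on_def by (metis atLeastAtMost_iff order_refl zero_le_one zero_less_one)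
  then have "((\<lambda>t. ennreal (l t)) \<longlongrightarrow> ennreal 1) (at_left 1)" by (rule tendsto_ennrealI)
  \<comment> \<open>The factors multiplied have limits \<open>L\<close> and \<open>L\<close>, then
    \<open>L * L\<close> and 1, so the indeterminate product of 0 and infinity does not
    arise.\<close>
  then have "((\<lambda>t. ennreal (sqrt (\<omega> (1 - t) / Q (1 - t))) * ennreal (sqrt (\<omega> (1 - t) / Q (1 - t))) * ennreal (l t))
      \<longlongrightarrow> L * L * ennreal 1) (at_left 1)"
    by (intro tendsto_mult_ennreal L1) auto
  moreover have "\<forall>\<^sub>F t in at_left 1.
      ennreal (sqrt (\<omega> (1 - t) / Q (1 - t))) * ennreal (sqrt (\<omega> (1 - t) / Q (1 - t))) * ennreal (l t)
        = ennreal (theta0 l Q \<omega> t)"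
    using near
  proof eventually_elim
    case (elim t)
    have "ennreal (sqrt r) * ennreal (sqrt r) * ennreal y = ennreal (r * y)" if "0 \<le> r" "0 \<le> y" for r y
      using that by (simp flip: ennreal_mult)
    moreover have "0 \<le> \<omega> (1 - t) / Q (1 - t)" "0 \<le> l t" using elim nonneg[of t] nonneg[of "1 - t"] by auto
    ultimately show ?case unfolding theta0_def .
  qed
  ultimately have lim: "((\<lambda>t. ennreal (theta0 l Q \<omega> t)) \<longlongrightarrow> L * L) (at_left 1)"
    by (auto intro: Lim_transform_eventually)
  then have at1: "theta_at1 l Q \<omega> = L * L" unfolding theta_at1_def by (intro tendsto_Lim) auto
  then have "L \<noteq> top" using fin by auto
  then obtain \<sigma> where \<sigma>: "0 \<le> \<sigma>" "L = ennreal \<sigma>" by (cases L) auto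
  then have LL: "L * L = ennreal (\<sigma>\<^sup>2)" by (simp add: power2_eq_square ennreal_mult')
  have "((\<lambda>t. theta0 l Q \<omega> t) \<longlongrightarrow> \<sigma>\<^sup>2) (at_left 1)"
  proof (rule tendsto_ennrealD)
    show "((\<lambda>t. ennreal (theta0 l Q \<omega> t)) \<longlongrightarrow> ennreal (\<sigma>\<^sup>2)) (at_left 1)" using lim LL by simp
    show "\<forall>\<^sub>F t in at_left 1. 0 \<le> theta0 l Q \<omega> t"
      using near
    proof eventually_elim
      case (elim t)
      then show ?case using nonneg[of t] nonneg[of "1 - t"] by (simp add: theta0_def)
    qed
  qed simp
  moreover have "theta l Q \<omega> 1 = \<sigma>\<^sup>2" by (simp add: theta_def at1 LL)
  ultimately show thesis using that[of \<sigma>] \<sigma> sigma by blast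
qed

text \<open>Away from 1 \<open>theta\<close> coincides with the quotient \<open>theta0\<close>; at 1
  continuity is the preceding limit. Continuity on the closed interval extends the growth given by
  the positive derivative to both endpoints.\<close>

lemma theta_continuous_strict_mono:
  assumes reg: "regular_data l Q \<omega> \<phi>" and fin: "theta_at1 l Q \<omega> < \<infinity>"
  shows "continuous_on {0..1} (theta l Q \<omega>)" "strict_mono_on {0..1} (theta l Q \<omega>)"
proof -
  have cont: "continuous_on {0..1} l" "continuous_on {0..1} Q" "continuous_on {0..1} \<omega>"
    and Q: "\<And>t. t \<in> {0..1} \<Longrightarrow> Q t = 0 \<longleftrightarrow> t = 0"
    and C1: "theta0 l Q \<omega> C1_differentiable_on {0<..<1}"
    and pos: "\<And>t. t \<in> {0<..<1} \<Longrightarrow> 0 < deriv (theta0 l Q \<omega>) t"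
    using reg unfolding regular_data_def by blast+
  \<comment> \<open>For \<open>t < 1\<close> the argument \<open>1 - t\<close> differs from 0, the
    only zero of \<open>Q\<close>.\<close>
  have c0: "continuous_on {0..<1} (theta0 l Q \<omega>)"
    unfolding theta0_def[abs_def]
    by (intro continuous_intros continuous_on_compose2[OF cont(3)] continuous_on_compose2[OF cont(2)]
        continuous_on_subset[OF cont(1)]) (auto simp: Q)
  show cont_theta: "continuous_on {0..1} (theta l Q \<omega>)"
    unfolding continuous_on_def
  proof
    fix t :: real assume t: "t \<in> {0..1}"
    show "(theta l Q \<omega> \<longlongrightarrow> theta l Q \<omega> t) (at t within {0..1})"
    proof (cases "t = 1")
      case True
      obtain \<sigma> where \<sigma>: "theta l Q \<omega> 1 = \<sigma>\<^sup>2" "(theta0 l Q \<omega> \<longlongrightarrow> \<sigma>\<^sup>2) (at_left 1)"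
        using theta_at_1_limit[OF reg fin] by blast
      have "(theta l Q \<omega> \<longlongrightarrow> \<sigma>\<^sup>2) (at_left 1)"
        by (rule Lim_transform_eventually[OF \<sigma>(2)]) (auto simp: theta_def eventually_at_filter)
      then show ?thesis using True \<sigma>(1) at_within_Icc_at_left[of 0 "1::real"] by simp
    next
      case False
      then have "at t within {0..1} = at t within {0..<1}"
        using t by (intro at_within_nhd[of t "{..<1}"]) auto
      moreover have "(theta0 l Q \<omega> \<longlongrightarrow> theta0 l Q \<omega> t) (at t within {0..<1})"
        using c0 t False by (auto simp: continuous_on_def)
      then have "(theta l Q \<omega> \<longlongrightarrow> theta0 l Q \<omega> t) (at t within {0..<1})"
        by (rule Lim_transform_eventually) (auto simp: theta_def eventually_at_filter)
      ultimately show ?thesis using False by (simp add: theta_def)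
    qed
  qed
  show "strict_mono_on {0..1} (theta l Q \<omega>)"
  proof (rule strict_mono_onI)
    fix r s :: real assume rs: "r \<in> {0..1}" "s \<in> {0..1}" "r < s"
    show "theta l Q \<omega> r < theta l Q \<omega> s"
    proof (rule DERIV_pos_imp_increasing_open[OF rs(3)])
      show "continuous_on {r..s} (theta l Q \<omega>)"
        using rs by (intro continuous_on_subset[OF cont_theta]) auto
      fix x assume "r < x" "x < s"
      then have x: "x \<in> {0<..<1}" using rs by auto
      then obtain D where D: "(theta0 l Q \<omega> has_real_derivative D) (at x)"
        using C1 unfolding C1_differentiable_on_def has_real_derivative_iff_has_vector_derivative by blast
      have "(theta l Q \<omega> has_real_derivative D) (at x)"
        by (rule has_field_derivative_transform_within_open[OF D, of "{0<..<1}"])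
           (use x in \<open>auto simp: theta_def\<close>)
      moreover have "0 < D" using pos[OF x] DERIV_imp_deriv[OF D] by simp
      ultimately show "\<exists>y. (theta l Q \<omega> has_real_derivative y) (at x) \<and> 0 < y" by blast
    qed
  qed
qed

theorem theorem2p18:
  fixes l Q \<omega> \<phi> :: "real \<Rightarrow> real"
  assumes "regular_data l Q \<omega> \<phi>"
    and "theta_at1 l Q \<omega> < \<infinity>"
    and "mono_on {0<..<1} (Phi l Q \<omega>)"
  shows "\<forall>s\<ge>0. g_fun l Q \<omega> s = min (sigma_bar Q \<omega> * ennreal s) (ennreal (2 * Psi \<omega> 1))"
proof (intro allI impI)
  fix s :: real assume s: "0 \<le> s"
  obtain \<sigma> where \<sigma>: "0 \<le> \<sigma>" "sigma_bar Q \<omega> = ennreal \<sigma>" "theta l Q \<omega> 1 = \<sigma>\<^sup>2"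
    using theta_at_1_limit[OF assms(1,2)] by blast
  have \<omega>: "continuous_on {0..1} \<omega>" "\<And>t. t \<in> {0..1} \<Longrightarrow> 0 \<le> \<omega> t" and l0: "l 0 = 0"
    using assms(1) by (auto simp: regular_data_def)
  \<comment> \<open>Composing with the projection onto the unit interval extends the coefficients to
    continuous functions on the line, as the locale demands, without changing them on the
    interval.\<close>
  define clamp where "clamp t = max 0 (min 1 t)" for t :: real
  have clamp: "clamp t \<in> {0..1}" "t \<in> {0..1} \<Longrightarrow> clamp t = t" for t by (auto simp: clamp_def)
  have clamp_cont: "continuous_on UNIV clamp" unfolding clamp_def by (intro continuous_intros)
  define \<theta> w where "\<theta> t = theta l Q \<omega> (clamp t)" and "w t = \<omega> (1 - clamp t)" for t
  interpret clairaut \<theta> w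
  proof
    show "continuous_on UNIV \<theta>" unfolding \<theta>_def
      using clamp(1) by (intro continuous_on_compose2[OF theta_continuous_strict_mono(1)[OF assms(1,2)] clamp_cont]) auto
    show "continuous_on UNIV w" unfolding w_def
      using clamp(1) by (intro continuous_on_compose2[OF \<omega>(1)] continuous_intros clamp_cont) auto
    show "strict_mono_on {0..1} \<theta>"
      using theta_continuous_strict_mono(2)[OF assms(1,2)] by (simp add: strict_mono_on_def \<theta>_def clamp)
    show "\<theta> 0 = 0" using l0 by (simp add: \<theta>_def clamp theta_def theta0_def)
    show "0 \<le> w t" for t using clamp(1)[of t] by (auto simp: w_def intro!: \<omega>(2))
  qed
  have "Phi l Q \<omega> x = 2 * (\<integral>\<^sup>+t. ennreal (sqrt (\<theta> x * w t / (\<theta> t * (\<theta> t - \<theta> x)))) \<partial>lebesgue_on {x<..<1})"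
    if "x \<in> {0<..<1}" for x
    unfolding Phi_def using that
    by (intro arg_cong[where f = "\<lambda>y. 2 * y"] nn_integral_cong) (simp add: \<theta>_def w_def clamp)
  then have mono: "mono_on {0<..<1} (\<lambda>x. 2 * (\<integral>\<^sup>+t. ennreal (sqrt (\<theta> x * w t / (\<theta> t * (\<theta> t - \<theta> x)))) \<partial>lebesgue_on {x<..<1}))"
    using assms(3) by (simp add: mono_on_def)
  have len: "(\<integral>\<^sup>+x. ennreal (sqrt (theta l Q \<omega> (v x) * \<bar>u' x\<bar>\<^sup>2 + \<omega> (1 - v x) * \<bar>v' x\<bar>\<^sup>2)) \<partial>unit_lebesgue)
      = (\<integral>\<^sup>+x. speed u' v v' x \<partial>unit_lebesgue)" if "\<forall>x\<in>{0..1}. 0 \<le> v x \<and> v x \<le> 1" for u' v v'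
    using that by (intro nn_integral_cong) (simp add: \<theta>_def w_def clamp)
  have "g_fun l Q \<omega> s = Inf {(\<integral>\<^sup>+x. speed u' v v' x \<partial>unit_lebesgue) | u u' v v'. H1_unit u u' \<and> H1_unit v v' \<and>
            continuous_on {0..1} u \<and> continuous_on {0..1} v \<and> u 0 = 0 \<and> u 1 = s \<and>
            (\<forall>x\<in>{0..1}. 0 \<le> v x \<and> v x \<le> 1) \<and> v 0 = 1 \<and> v 1 = 1}"
    unfolding g_fun_def
    \<comment> \<open>The two length integrals agree only if \<open>v\<close> takes values in the
      unit interval, so the constraints have to be available while the integral is
      rewritten.\<close>
    by (rule arg_cong[where f = Inf], rule Collect_cong, (rule ex_cong1)+, rule rev_conj_cong, rule refl)
       (subst len, simp_all)
  also have "\<dots> = min (ennreal (sqrt (\<theta> 1) * s)) (ennreal (2 * integral {0..1} (\<lambda>t. sqrt (w t))))"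
    by (rule Inf_length[OF mono s])
  also have "sqrt (\<theta> 1) = \<sigma>" using \<sigma> by (simp add: \<theta>_def clamp)
  also have "ennreal (\<sigma> * s) = sigma_bar Q \<omega> * ennreal s" using \<sigma> by (simp add: ennreal_mult')
  also have "integral {0..1} (\<lambda>t. sqrt (w t)) = Psi \<omega> 1"
    unfolding Psi_def by (intro Henstock_Kurzweil_Integration.integral_cong) (simp add: w_def clamp)
  finally show "g_fun l Q \<omega> s = min (sigma_bar Q \<omega> * ennreal s) (ennreal (2 * Psi \<omega> 1))" .
qed

end
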